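(* Let $(W,S)$ be a Coxeter system (of arbitrary rank). The intersection of an arbitrary (possibly infinite) nonempty family of locally parabolic subgroups of $W$ is again a locally parabolic subgroup of $W$.
   Context: Let $\Phi$ be the root system of $W$ in its geometric representation (simple roots $\alpha_s$, $s\in S$), $\Phi^+$ the positive roots, $s_\gamma$ the reflection of $\gamma\in\Phi$. For a reflection subgroup $G$ (subgroup generated by reflections), $\Phi(G)=\{\gamma\in\Phi\mid s_\gamma\in G\}$, $\Pi(G)$ is the set of $\gamma\in\Phi(G)\cap\Phi^+$ not expressible as $\sum c_i\beta_i$ with $c_i>0$, $\beta_i\in\Phi(G)\cap\Phi^+$ unless all $\beta_i=\gamma$, and $S(G)=\{s_\gamma\mid\gamma\in\Pi(G)\}$ is its canonical generating set ($(G,S(G))$ is a Coxeter system). A subgroup $G\le W$ is locally parabolic if $G$ is a reflection subgroup and every finite subset of $S(G)$ is conjugate in $W$ (by a single element) to a subset of $S$. *)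

theory Defs
  imports Complex_Main "HOL-Library.Extended_Nat"
begin

text \<open>Coxeter system given by a Coxeter matrix on the index type 'a (the set S of
simple reflections is indexed by all of 'a; the rank is arbitrary, possibly infinite).
The value infinity of m is encoded by the enat value infinity.\<close>

definition coxeter_matrix :: "('a \<Rightarrow> 'a \<Rightarrow> enat) \<Rightarrow> bool" where
  "coxeter_matrix m \<longleftrightarrow> (\<forall>s t. m s t = m t s) \<and> (\<forall>s. m s s = 1)
      \<and> (\<forall>s t. s \<noteq> t \<longrightarrow> m s t \<ge> 2)"

text \<open>Geometric representation: V = finitely supported functions 'a \<Rightarrow> real,
simple root alpha_s = indicator of s, B(alpha_s, alpha_t) = - cos(pi / m s t)
(and -1 if m s t = infinity).\<close>

definition cox_b :: "('a \<Rightarrow> 'a \<Rightarrow> enat) \<Rightarrow> 'a \<Rightarrow> 'a \<Rightarrow> real" where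
  "cox_b m s t = (case m s t of enat k \<Rightarrow> - cos (pi / real k) | \<infinity> \<Rightarrow> -1)"

definition supp :: "('a \<Rightarrow> real) \<Rightarrow> 'a set" where
  "supp v = {s. v s \<noteq> 0}"

definition cox_B :: "('a \<Rightarrow> 'a \<Rightarrow> enat) \<Rightarrow> ('a \<Rightarrow> real) \<Rightarrow> ('a \<Rightarrow> real) \<Rightarrow> real" where
  "cox_B m u v = (\<Sum>s\<in>supp u. \<Sum>t\<in>supp v. u s * cox_b m s t * v t)"

definition simple_root :: "'a \<Rightarrow> ('a \<Rightarrow> real)" where
  "simple_root s = (\<lambda>t. if t = s then 1 else 0)"

definition refl_along :: "('a \<Rightarrow> 'a \<Rightarrow> enat) \<Rightarrow> ('a \<Rightarrow> real) \<Rightarrow> ('a \<Rightarrow> real) \<Rightarrow> ('a \<Rightarrow> real)" where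
  "refl_along m \<gamma> = (\<lambda>v. (\<lambda>x. v x - 2 * cox_B m \<gamma> v * \<gamma> x))"

definition simple_refl :: "('a \<Rightarrow> 'a \<Rightarrow> enat) \<Rightarrow> 'a \<Rightarrow> (('a \<Rightarrow> real) \<Rightarrow> ('a \<Rightarrow> real))" where
  "simple_refl m s = refl_along m (simple_root s)"

text \<open>The subgroup generated by a set R of involutions (closure under composition,
which is a group since generators are involutions).\<close>
inductive_set gen_by :: "(('a \<Rightarrow> real) \<Rightarrow> ('a \<Rightarrow> real)) set \<Rightarrow> (('a \<Rightarrow> real) \<Rightarrow> ('a \<Rightarrow> real)) set"
  for R where
    gen_id: "id \<in> gen_by R"
  | gen_step: "r \<in> R \<Longrightarrow> w \<in> gen_by R \<Longrightarrow> r \<circ> w \<in> gen_by R"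

text \<open>The Coxeter group W, realised faithfully via its geometric representation.\<close>
definition cox_W :: "('a \<Rightarrow> 'a \<Rightarrow> enat) \<Rightarrow> (('a \<Rightarrow> real) \<Rightarrow> ('a \<Rightarrow> real)) set" where
  "cox_W m = gen_by (range (simple_refl m))"

definition roots :: "('a \<Rightarrow> 'a \<Rightarrow> enat) \<Rightarrow> ('a \<Rightarrow> real) set" where
  "roots m = {w (simple_root s) | w s. w \<in> cox_W m}"

definition pos_roots :: "('a \<Rightarrow> 'a \<Rightarrow> enat) \<Rightarrow> ('a \<Rightarrow> real) set" where
  "pos_roots m = {\<gamma> \<in> roots m. \<forall>s. \<gamma> s \<ge> 0}"

definition reflections :: "('a \<Rightarrow> 'a \<Rightarrow> enat) \<Rightarrow> (('a \<Rightarrow> real) \<Rightarrow> ('a \<Rightarrow> real)) set" where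
  "reflections m = refl_along m ` roots m"

definition reflection_subgroup :: "('a \<Rightarrow> 'a \<Rightarrow> enat) \<Rightarrow> (('a \<Rightarrow> real) \<Rightarrow> ('a \<Rightarrow> real)) set \<Rightarrow> bool" where
  "reflection_subgroup m G \<longleftrightarrow> (\<exists>R \<subseteq> reflections m. G = gen_by R)"

definition roots_of :: "('a \<Rightarrow> 'a \<Rightarrow> enat) \<Rightarrow> (('a \<Rightarrow> real) \<Rightarrow> ('a \<Rightarrow> real)) set \<Rightarrow> ('a \<Rightarrow> real) set" where
  "roots_of m G = {\<gamma> \<in> roots m. refl_along m \<gamma> \<in> G}"

definition simple_roots_of :: "('a \<Rightarrow> 'a \<Rightarrow> enat) \<Rightarrow> (('a \<Rightarrow> real) \<Rightarrow> ('a \<Rightarrow> real)) set \<Rightarrow> ('a \<Rightarrow> real) set" where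
  "simple_roots_of m G = {\<gamma> \<in> roots_of m G \<inter> pos_roots m.
      \<not> (\<exists>B c. finite B \<and> B \<subseteq> roots_of m G \<inter> pos_roots m \<and> \<not> B \<subseteq> {\<gamma>}
              \<and> (\<forall>\<beta>\<in>B. c \<beta> > (0::real))
              \<and> (\<forall>x. \<gamma> x = (\<Sum>\<beta>\<in>B. c \<beta> * \<beta> x)))}"

definition canonical_gens :: "('a \<Rightarrow> 'a \<Rightarrow> enat) \<Rightarrow> (('a \<Rightarrow> real) \<Rightarrow> ('a \<Rightarrow> real)) set \<Rightarrow> (('a \<Rightarrow> real) \<Rightarrow> ('a \<Rightarrow> real)) set" where
  "canonical_gens m G = refl_along m ` simple_roots_of m G"

definition locally_parabolic :: "('a \<Rightarrow> 'a \<Rightarrow> enat) \<Rightarrow> (('a \<Rightarrow> real) \<Rightarrow> ('a \<Rightarrow> real)) set \<Rightarrow> bool" where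
  "locally_parabolic m G \<longleftrightarrow> reflection_subgroup m G \<and>
     (\<forall>F. finite F \<and> F \<subseteq> canonical_gens m G \<longrightarrow>
        (\<exists>w \<in> cox_W m. (\<lambda>f. w \<circ> f \<circ> inv w) ` F \<subseteq> range (simple_refl m)))"

end

theory Submission
  imports Defs
begin

text \<open>
  A locally parabolic subgroup \<open>G\<close> is generated by its canonical generators, so a finite
  \<open>X \<subseteq> G\<close> lies in a parabolic subgroup of finite rank that is contained in \<open>G\<close>. Among the
  parabolic subgroups containing \<open>X\<close> there is a least one as soon as one of them has finite
  rank: in \<open>P \<inter> Q = z W\<^sub>K z\<^sup>-\<^sup>1\<close> with \<open>P = x W\<^sub>I x\<^sup>-\<^sup>1\<close> one can take \<open>K \<subseteq> I\<close>, so a \<open>P\<close> of minimal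
  rank is the least. This parabolic closure of \<open>X\<close> lies in every member of the family that
  contains \<open>X\<close>, hence in the intersection. Conversely, a group that contains a
  parabolic subgroup around each of its finite subsets is locally parabolic: choosing \<open>v\<close> with all \<open>v \<alpha>\<^sub>i\<close> (\<open>i \<in> I\<close>) positive,
  the canonical roots of \<open>G\<close> lying in \<open>v W\<^sub>I v\<^sup>-\<^sup>1\<close> are indecomposable there and are thus
  among the \<open>v \<alpha>\<^sub>i\<close>.
\<close>

section \<open>The bilinear form and isometries\<close>

lemma supp_simple_root [simp]: "supp (simple_root s) = {s}"
  by (auto simp: supp_def simple_root_def)

lemma finite_supp_lincomb:
  assumes "finite (supp u)" "finite (supp v)"
  shows "finite (supp (\<lambda>x. u x + c * v x))"
  by (rule finite_subset[of _ "supp u \<union> supp v"]) (use assms in \<open>auto simp: supp_def\<close>)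

text \<open>Enlarging the index sets beyond the supports only adds zero terms. This lets forms of
  different vectors be summed over common sets, although the support of a sum may shrink.\<close>

lemma cox_B_on:
  assumes "finite A" "supp u \<subseteq> A" "finite C" "supp v \<subseteq> C"
  shows "cox_B m u v = (\<Sum>s\<in>A. \<Sum>t\<in>C. u s * cox_b m s t * v t)"
proof -
  have "(\<Sum>t\<in>supp v. u s * cox_b m s t * v t) = (\<Sum>t\<in>C. u s * cox_b m s t * v t)" for s
    by (rule sum.mono_neutral_left) (use assms in \<open>auto simp: supp_def\<close>)
  then have "cox_B m u v = (\<Sum>s\<in>supp u. \<Sum>t\<in>C. u s * cox_b m s t * v t)"
    by (simp add: cox_B_def)
  also have "\<dots> = (\<Sum>s\<in>A. \<Sum>t\<in>C. u s * cox_b m s t * v t)"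
    by (rule sum.mono_neutral_left) (use assms in \<open>auto simp: supp_def\<close>)
  finally show ?thesis .
qed

lemma cox_B_lincomb_right:
  assumes "finite (supp u)" "finite (supp v)" "finite (supp v')"
  shows "cox_B m u (\<lambda>x. v x + c * v' x) = cox_B m u v + c * cox_B m u v'"
proof -
  let ?C = "supp v \<union> supp v'"
  have "supp (\<lambda>x. v x + c * v' x) \<subseteq> ?C" by (auto simp: supp_def)
  then show ?thesis
    using assms
    by (simp add: cox_B_on[of "supp u" u ?C] sum.distrib sum_distrib_left algebra_simps)
qed

lemma cox_B_infinite: "infinite (supp v) \<Longrightarrow> cox_B m u v = 0"
  by (simp add: cox_B_def)

lemma cox_B_simple_roots: "cox_B m (simple_root s) (simple_root t) = cox_b m s t"
  by (simp add: cox_B_def) (simp add: simple_root_def)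

text \<open>Isometries of the geometric representation; like all elements of \<open>W\<close>, they
  must fix the functions of infinite support, which lie outside that representation.\<close>

definition isom :: "('a \<Rightarrow> 'a \<Rightarrow> enat) \<Rightarrow> (('a \<Rightarrow> real) \<Rightarrow> ('a \<Rightarrow> real)) \<Rightarrow> bool" where
  "isom m w \<longleftrightarrow> bij w \<and> (\<forall>v. infinite (supp v) \<longrightarrow> w v = v)
     \<and> (\<forall>v. finite (supp v) \<longrightarrow> finite (supp (w v)))
     \<and> (\<forall>u v c. finite (supp u) \<longrightarrow> finite (supp v) \<longrightarrow>
           w (\<lambda>x. u x + c * v x) = (\<lambda>x. w u x + c * w v x))
     \<and> (\<forall>u v. finite (supp u) \<longrightarrow> finite (supp v) \<longrightarrow> cox_B m (w u) (w v) = cox_B m u v)"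

lemma isom_bij: "isom m w \<Longrightarrow> bij w"
  and isom_infinite: "isom m w \<Longrightarrow> infinite (supp v) \<Longrightarrow> w v = v"
  and isom_finite: "isom m w \<Longrightarrow> finite (supp v) \<Longrightarrow> finite (supp (w v))"
  and isom_lincomb: "isom m w \<Longrightarrow> finite (supp u) \<Longrightarrow> finite (supp v) \<Longrightarrow>
        w (\<lambda>x. u x + c * v x) = (\<lambda>x. w u x + c * w v x)"
  and isom_cox_B: "isom m w \<Longrightarrow> finite (supp u) \<Longrightarrow> finite (supp v) \<Longrightarrow>
        cox_B m (w u) (w v) = cox_B m u v"
  by (auto simp: isom_def)

lemma isom_inv_cancel [simp]:
  "isom m w \<Longrightarrow> w (inv w v) = v" "isom m w \<Longrightarrow> inv w (w v) = v"
  "isom m w \<Longrightarrow> w \<circ> inv w = id" "isom m w \<Longrightarrow> inv w \<circ> w = id"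
  by (auto simp: fun_eq_iff bij_is_inj bij_is_surj surj_f_inv_f dest!: isom_bij)

lemma isom_id: "isom m id"
  by (simp add: isom_def)

lemma isom_comp: "isom m v \<Longrightarrow> isom m w \<Longrightarrow> isom m (v \<circ> w)"
  by (simp add: isom_def bij_comp)

lemma isom_scale:
  assumes "isom m w" "finite (supp v)"
  shows "w (\<lambda>x. c * v x) = (\<lambda>x. c * w v x)"
proof -
  have z: "finite (supp (\<lambda>x::'a. 0::real))" by (simp add: supp_def)
  \<comment> \<open>The combination \<open>0 + (-1) * 0\<close> gives
    \<open>w 0 = w 0 - w 0\<close>.\<close>
  have "w (\<lambda>x. 0) = (\<lambda>x. 0)" using isom_lincomb[OF assms(1) z z, of "-1"] by simp
  then show ?thesis using isom_lincomb[OF assms(1) z assms(2), of c] by simp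
qed

lemma finite_supp_sum:
  assumes "finite I" "\<And>i. i \<in> I \<Longrightarrow> finite (supp (f i))"
  shows "finite (supp (\<lambda>x. \<Sum>i\<in>I. c i * f i x))"
proof (rule finite_subset)
  show "supp (\<lambda>x. \<Sum>i\<in>I. c i * f i x) \<subseteq> (\<Union>i\<in>I. supp (f i))"
  proof
    fix x assume "x \<in> supp (\<lambda>x. \<Sum>i\<in>I. c i * f i x)"
    then have "(\<Sum>i\<in>I. c i * f i x) \<noteq> 0" by (simp add: supp_def)
    then obtain i where "i \<in> I" "c i * f i x \<noteq> 0" by (rule sum.not_neutral_contains_not_neutral)
    then show "x \<in> (\<Union>i\<in>I. supp (f i))" by (auto simp: supp_def)
  qed
qed (use assms in auto)

lemma isom_sum:
  assumes w: "isom m w" and "finite I" "\<And>i. i \<in> I \<Longrightarrow> finite (supp (f i))"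
  shows "w (\<lambda>x. \<Sum>i\<in>I. c i * f i x) = (\<lambda>x. \<Sum>i\<in>I. c i * w (f i) x)"
  using assms(2,3)
proof (induction I)
  case empty
  have "finite (supp (\<lambda>x::'a. 0::real))" by (simp add: supp_def)
  from isom_scale[OF w this, of 0] show ?case by simp
next
  case (insert i I)
  have "w (\<lambda>x. \<Sum>j\<in>insert i I. c j * f j x) = w (\<lambda>x. (\<Sum>j\<in>I. c j * f j x) + c i * f i x)"
    using insert.hyps by (simp add: add.commute)
  also have "\<dots> = (\<lambda>x. w (\<lambda>x. \<Sum>j\<in>I. c j * f j x) x + c i * w (f i) x)"
    using insert by (intro isom_lincomb[OF w] finite_supp_sum) auto
  finally show ?case using insert by (simp add: add.commute)
qed

lemma simple_root_expansion:
  assumes "finite A" "supp v \<subseteq> A"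
  shows "v = (\<lambda>x. \<Sum>s\<in>A. v s * simple_root s x)"
proof
  fix x
  have "(\<Sum>s\<in>A. v s * simple_root s x) = (\<Sum>s\<in>A. if s = x then v s else 0)"
    by (rule sum.cong) (auto simp: simple_root_def)
  also have "\<dots> = v x" using assms by (auto simp: supp_def)
  finally show "v x = (\<Sum>s\<in>A. v s * simple_root s x)" by simp
qed

text \<open>Since \<open>w\<close> preserves the form, it carries the reflection in
  \<open>\<gamma>\<close> to the reflection in \<open>w \<gamma>\<close>. On vectors of infinite
  support every map involved is the identity.\<close>

lemma refl_along_conj:
  assumes w: "isom m w" and "finite (supp \<gamma>)"
  shows "refl_along m (w \<gamma>) \<circ> w = w \<circ> refl_along m \<gamma>"
proof
  fix v
  show "(refl_along m (w \<gamma>) \<circ> w) v = (w \<circ> refl_along m \<gamma>) v"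
  proof (cases "finite (supp v)")
    case True
    have "refl_along m \<gamma> v = (\<lambda>x. v x + (- 2 * cox_B m \<gamma> v) * \<gamma> x)"
      by (simp add: refl_along_def)
    then have "w (refl_along m \<gamma> v) = (\<lambda>x. w v x + (- 2 * cox_B m \<gamma> v) * w \<gamma> x)"
      by (simp only: isom_lincomb[OF w True assms(2)])
    then show ?thesis using isom_cox_B[OF w assms(2) True] by (simp add: refl_along_def)
  next
    case False
    then show ?thesis by (simp add: isom_infinite[OF w] refl_along_def cox_B_infinite)
  qed
qed

lemma refl_along_conj_inv:
  assumes "isom m w" "finite (supp \<gamma>)"
  shows "w \<circ> refl_along m \<gamma> \<circ> inv w = refl_along m (w \<gamma>)"
  using refl_along_conj[OF assms] assms(1) by (metis comp_assoc comp_id isom_inv_cancel(3))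

section \<open>Groups generated by involutions\<close>

lemma gen_by_id: "id \<in> gen_by R"
  by (rule gen_by.gen_id)

lemma gen_by_step: "r \<in> R \<Longrightarrow> w \<in> gen_by R \<Longrightarrow> r \<circ> w \<in> gen_by R"
  by (rule gen_by.gen_step)

lemma gen_by_induct [consumes 1, case_names id step]:
  assumes "w \<in> gen_by R" "P id"
    and "\<And>r w. r \<in> R \<Longrightarrow> w \<in> gen_by R \<Longrightarrow> P w \<Longrightarrow> P (r \<circ> w)"
  shows "P w"
  using assms(1) by (rule gen_by.induct) (fact assms)+

lemma gen_by_incl: "r \<in> R \<Longrightarrow> r \<in> gen_by R"
  using gen_by_step[OF _ gen_by_id] by (metis comp_id)

lemma gen_by_comp: "v \<in> gen_by R \<Longrightarrow> w \<in> gen_by R \<Longrightarrow> v \<circ> w \<in> gen_by R"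
  by (induction rule: gen_by_induct) (auto simp: comp_assoc intro: gen_by_id gen_by_step)

lemma gen_by_least:
  assumes "R \<subseteq> G" "id \<in> G" "\<And>f g. f \<in> G \<Longrightarrow> g \<in> G \<Longrightarrow> f \<circ> g \<in> G"
  shows "gen_by R \<subseteq> G"
proof
  fix w assume "w \<in> gen_by R"
  then show "w \<in> G"
  proof (induction rule: gen_by_induct)
    case id
    show "id \<in> G" by (fact assms(2))
  next
    case (step r w)
    then show "r \<circ> w \<in> G" using assms(1,3) by blast
  qed
qed

lemma gen_by_mono: "R \<subseteq> R' \<Longrightarrow> gen_by R \<subseteq> gen_by R'"
  by (rule gen_by_least) (auto intro: gen_by_incl gen_by_id gen_by_comp)

lemma gen_by_finite:
  "w \<in> gen_by R \<Longrightarrow> \<exists>F. finite F \<and> F \<subseteq> R \<and> w \<in> gen_by F"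
proof (induction rule: gen_by_induct)
  case id
  have "id \<in> gen_by ({} :: (('a \<Rightarrow> real) \<Rightarrow> ('a \<Rightarrow> real)) set)" by (rule gen_by_id)
  then show ?case by blast
next
  case (step r w)
  then obtain F where F: "finite F" "F \<subseteq> R" "w \<in> gen_by F" by blast
  have "r \<circ> w \<in> gen_by (insert r F)"
    using F(3) gen_by_mono[of F "insert r F"] by (auto intro: gen_by_step)
  moreover have "finite (insert r F)" "insert r F \<subseteq> R" using F step(1) by auto
  ultimately show ?case by blast
qed

lemma gen_by_finite_set:
  assumes "finite X" "X \<subseteq> gen_by R"
  shows "\<exists>F. finite F \<and> F \<subseteq> R \<and> X \<subseteq> gen_by F"
proof -
  have "\<forall>w\<in>X. \<exists>F. finite F \<and> F \<subseteq> R \<and> w \<in> gen_by F" using gen_by_finite assms(2) by blast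
  then obtain F where F: "\<And>w. w \<in> X \<Longrightarrow> finite (F w) \<and> F w \<subseteq> R \<and> w \<in> gen_by (F w)" by metis
  have "X \<subseteq> gen_by (\<Union>w\<in>X. F w)"
    using F gen_by_mono[of "F _" "\<Union>w\<in>X. F w"] by blast
  then show ?thesis using F assms(1) by (intro exI[of _ "\<Union>w\<in>X. F w"]) auto
qed

lemma gen_by_conj:
  assumes w: "bij w" and "f \<in> gen_by R"
  shows "w \<circ> f \<circ> inv w \<in> gen_by ((\<lambda>f. w \<circ> f \<circ> inv w) ` R)"
  using assms(2)
proof (induction rule: gen_by_induct)
  case id
  have "w \<circ> id \<circ> inv w = id" using w by (auto simp: fun_eq_iff bij_is_surj surj_f_inv_f)
  then show ?case using gen_by_id by metis
next
  case (step r f)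
  have "inv w (w v) = v" for v using w by (simp add: bij_is_inj)
  then have "w \<circ> (r \<circ> f) \<circ> inv w = (w \<circ> r \<circ> inv w) \<circ> (w \<circ> f \<circ> inv w)"
    by (simp add: comp_def)
  moreover have "(w \<circ> r \<circ> inv w) \<circ> (w \<circ> f \<circ> inv w) \<in> gen_by ((\<lambda>f. w \<circ> f \<circ> inv w) ` R)"
    by (rule gen_by_step[OF imageI[OF step(1)] step(3)])
  ultimately show "w \<circ> (r \<circ> f) \<circ> inv w \<in> gen_by ((\<lambda>f. w \<circ> f \<circ> inv w) ` R)" by metis
qed

section \<open>Words and lengths\<close>

locale coxeter =
  fixes m :: "'a \<Rightarrow> 'a \<Rightarrow> enat"
  assumes coxeter_matrix: "coxeter_matrix m"
begin

abbreviation "\<sigma> \<equiv> simple_refl m"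
abbreviation "\<alpha> \<equiv> (simple_root :: 'a \<Rightarrow> 'a \<Rightarrow> real)"
abbreviation "\<b> \<equiv> cox_b m"
abbreviation "W J \<equiv> gen_by (\<sigma> ` J)"

lemma cox_b_sym: "\<b> s t = \<b> t s"
  using coxeter_matrix by (simp add: cox_b_def coxeter_matrix_def)

lemma cox_b_self [simp]: "\<b> s s = 1"
proof -
  have "m s s = enat 1" using coxeter_matrix by (simp add: coxeter_matrix_def one_enat_def)
  then show ?thesis by (simp add: cox_b_def)
qed

lemma cox_B_sym: "cox_B m u v = cox_B m v u"
  unfolding cox_B_def by (subst sum.swap) (simp add: cox_b_sym mult.commute mult.left_commute)

text \<open>Unit norm makes the reflection change the sign of \<open>cox_B m \<gamma> v\<close>, so
  that applying it twice returns \<open>v\<close>; bijectivity and invariance of the form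
  follow.\<close>

lemma isom_refl_along:
  assumes fin: "finite (supp \<gamma>)" and norm: "cox_B m \<gamma> \<gamma> = 1"
  shows "isom m (refl_along m \<gamma>)" and "refl_along m \<gamma> \<circ> refl_along m \<gamma> = id"
proof -
  let ?r = "refl_along m \<gamma>"
  have r: "?r v = (\<lambda>x. v x + (- 2 * cox_B m \<gamma> v) * \<gamma> x)" for v
    by (simp add: refl_along_def)
  have inf: "?r v = v" if "infinite (supp v)" for v
    using that by (simp add: r cox_B_infinite)
  have fins: "finite (supp (?r v))" if "finite (supp v)" for v
    unfolding r by (rule finite_supp_lincomb[OF that fin])
  have Br: "cox_B m u (?r v) = cox_B m u v - 2 * cox_B m \<gamma> v * cox_B m u \<gamma>"
    if "finite (supp u)" "finite (supp v)" for u v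
    unfolding r by (subst cox_B_lincomb_right[OF that fin]) simp
  have "?r (?r v) = v" for v
  proof (cases "finite (supp v)")
    case True
    have "cox_B m \<gamma> (?r v) = - cox_B m \<gamma> v" using Br[OF fin True] norm by simp
    then show ?thesis by (simp add: r)
  qed (simp add: inf)
  then show inv: "?r \<circ> ?r = id" by (simp add: comp_def id_def)
  have "bij ?r" using inv by (rule o_bij) (rule inv)
  moreover have "?r (\<lambda>x. u x + c * v x) = (\<lambda>x. ?r u x + c * ?r v x)"
    if "finite (supp u)" "finite (supp v)" for u v c
    using cox_B_lincomb_right[OF fin that, of m c] by (simp add: r algebra_simps)
  moreover have "cox_B m (?r u) (?r v) = cox_B m u v"
    if "finite (supp u)" "finite (supp v)" for u v
    using Br[OF fins[OF that(1)] that(2)] Br[OF that(2,1)] Br[OF fin that(1)] norm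
      cox_B_sym[of "?r u"] cox_B_sym[of v u] cox_B_sym[of v \<gamma>]
    by simp
  ultimately show "isom m ?r" using inf fins by (simp add: isom_def)
qed

lemma isom_simple_refl: "isom m (\<sigma> s)"
  and simple_refl_invol: "\<sigma> s \<circ> \<sigma> s = id"
  unfolding simple_refl_def by (rule isom_refl_along; simp add: cox_B_simple_roots)+

lemma simple_refl_cancel [simp]: "\<sigma> s (\<sigma> s v) = v" "\<sigma> s \<circ> (\<sigma> s \<circ> f) = f" "f \<circ> \<sigma> s \<circ> \<sigma> s = f"
proof -
  show *: "\<sigma> s (\<sigma> s v) = v" for v using simple_refl_invol[of s] by (metis comp_apply id_apply)
  show "\<sigma> s \<circ> (\<sigma> s \<circ> f) = f" "f \<circ> \<sigma> s \<circ> \<sigma> s = f" by (simp_all add: comp_def *)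
qed

lemma simple_refl_simple_root: "\<sigma> s (\<alpha> t) = (\<lambda>x. \<alpha> t x - 2 * \<b> s t * \<alpha> s x)"
  by (simp add: simple_refl_def refl_along_def cox_B_simple_roots)

lemma simple_refl_self: "\<sigma> s (\<alpha> s) = (\<lambda>x. - \<alpha> s x)"
  by (simp add: simple_refl_simple_root)

lemma simple_refl_other: "x \<noteq> s \<Longrightarrow> \<sigma> s v x = v x"
  by (simp add: simple_refl_def refl_along_def simple_root_def)

lemma isom_W: "w \<in> W J \<Longrightarrow> isom m w"
proof (induction rule: gen_by_induct)
  case id
  show "isom m id" by (rule isom_id)
next
  case (step r w)
  then show "isom m (r \<circ> w)" using isom_comp isom_simple_refl by blast
qed

primrec word :: "'a list \<Rightarrow> ('a \<Rightarrow> real) \<Rightarrow> ('a \<Rightarrow> real)" where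
  "word [] = id"
| "word (s # xs) = \<sigma> s \<circ> word xs"

lemma word_append: "word (xs @ ys) = word xs \<circ> word ys"
  by (induction xs) (simp_all add: comp_assoc)

lemma word_snoc: "word (xs @ [s]) = word xs \<circ> \<sigma> s"
  by (simp add: word_append)

lemma word_in_W: "set xs \<subseteq> J \<Longrightarrow> word xs \<in> W J"
  by (induction xs) (simp_all add: gen_by_id gen_by_step)

lemma W_word: "w \<in> W J \<Longrightarrow> \<exists>xs. set xs \<subseteq> J \<and> word xs = w"
proof (induction rule: gen_by_induct)
  case id
  have "set [] \<subseteq> J" "word [] = id" by simp_all
  then show ?case by blast
next
  case (step r w)
  then obtain s xs where "s \<in> J" "r = \<sigma> s" "set xs \<subseteq> J" "word xs = w" by blast
  then have "set (s # xs) \<subseteq> J" "word (s # xs) = r \<circ> w" by simp_all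
  then show ?case by blast
qed

text \<open>Supplies inverses: \<open>gen_by\<close> closes under composition only, but reversing a
  word of involutions inverts it.\<close>

lemma word_rev: "word (rev xs) = inv (word xs)"
proof -
  have "word (rev xs) \<circ> word xs = id" for xs
    by (induction xs) (simp_all add: word_append comp_assoc)
  from this[of xs] this[of "rev xs"] show ?thesis by (simp add: inv_unique_comp)
qed

lemma W_inv: "w \<in> W J \<Longrightarrow> inv w \<in> W J"
  using W_word[of w J] word_rev word_in_W by (metis set_rev)

text \<open>Length is relative to \<open>J\<close>, so that positivity can be argued inside
  \<open>W J\<close> and inside dihedral subgroups alike. Outside \<open>W J\<close> the value is
  unspecified.\<close>

definition len :: "'a set \<Rightarrow> (('a \<Rightarrow> real) \<Rightarrow> ('a \<Rightarrow> real)) \<Rightarrow> nat" where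
  "len J w = (LEAST n. \<exists>xs. set xs \<subseteq> J \<and> length xs = n \<and> word xs = w)"

lemma len_word_le: "set xs \<subseteq> J \<Longrightarrow> len J (word xs) \<le> length xs"
  unfolding len_def by (rule Least_le) blast

lemma reduced_word:
  assumes "w \<in> W J"
  obtains xs where "set xs \<subseteq> J" "length xs = len J w" "word xs = w"
proof -
  have "\<exists>n xs. set xs \<subseteq> J \<and> length xs = n \<and> word xs = w" using W_word[OF assms] by blast
  from LeastI_ex[OF this] show ?thesis using that unfolding len_def by blast
qed

lemma len_comp_le:
  assumes "I \<subseteq> J" "v \<in> W J" "u \<in> W I"
  shows "len J (v \<circ> u) \<le> len J v + len I u"
proof -
  obtain xs where xs: "set xs \<subseteq> J" "length xs = len J v" "word xs = v"
    using reduced_word[OF assms(2)] .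
  obtain ys where ys: "set ys \<subseteq> I" "length ys = len I u" "word ys = u"
    using reduced_word[OF assms(3)] .
  have "set (xs @ ys) \<subseteq> J" using xs ys assms(1) by auto
  from len_word_le[OF this] show ?thesis using xs ys by (simp add: word_append)
qed

lemma len_simple_le: "s \<in> J \<Longrightarrow> len J (\<sigma> s) \<le> 1"
  using len_word_le[of "[s]" J] by simp

lemma len_inv_le: "w \<in> W J \<Longrightarrow> len J (inv w) \<le> len J w"
  by (metis len_word_le length_rev reduced_word set_rev word_rev)

lemma inv_inv_W: "w \<in> W J \<Longrightarrow> inv (inv w) = w"
  using isom_bij isom_W inv_inv_eq by blast

lemma len_inv: "w \<in> W J \<Longrightarrow> len J (inv w) = len J w"
  using len_inv_le[of w J] len_inv_le[OF W_inv, of w J] inv_inv_W[of w J] by simp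

section \<open>Dihedral subgroups\<close>

text \<open>\<open>alt s t k\<close> is the alternating product of length \<open>k\<close> whose rightmost factor is \<open>t\<close>.\<close>

primrec alt :: "'a \<Rightarrow> 'a \<Rightarrow> nat \<Rightarrow> ('a \<Rightarrow> real) \<Rightarrow> ('a \<Rightarrow> real)" where
  "alt s t 0 = id"
| "alt s t (Suc k) = \<sigma> (if even k then t else s) \<circ> alt s t k"

lemma alt_Suc_right: "alt s t (Suc k) = alt t s k \<circ> \<sigma> t"
proof (induction k)
  case (Suc k)
  have "alt s t (Suc (Suc k)) = \<sigma> (if even k then s else t) \<circ> alt s t (Suc k)"
    by simp
  then show ?case unfolding Suc by (simp add: comp_assoc)
qed simp

lemma alt_word: "\<exists>xs. set xs \<subseteq> {s, t} \<and> length xs = k \<and> word xs = alt s t k"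
proof (induction k)
  case (Suc k)
  then obtain xs where "set xs \<subseteq> {s, t} \<and> length xs = k \<and> word xs = alt s t k" by blast
  then show ?case by (intro exI[of _ "(if even k then t else s) # xs"]) auto
qed (simp add: id_def)

text \<open>Isolates the rightmost \<open>n\<close> letters, where the braid relation can be
  applied.\<close>

lemma alt_split:
  "n \<le> k \<Longrightarrow> \<exists>ys. set ys \<subseteq> {s, t} \<and> length ys = k - n \<and> alt s t k = word ys \<circ> alt s t n"
proof (induction k)
  case (Suc k)
  show ?case
  proof (cases "n = Suc k")
    case False
    then obtain ys where "set ys \<subseteq> {s, t}" "length ys = k - n" "alt s t k = word ys \<circ> alt s t n"
      using Suc by fastforce
    then show ?thesis using Suc.prems False
      by (intro exI[of _ "(if even k then t else s) # ys"]) (auto simp: comp_assoc)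
  qed (auto intro: exI[of _ "[]"])
qed (auto intro: exI[of _ "[]"])

text \<open>Cancelling equal neighbours in a word in two letters leaves an alternating one.\<close>

lemma word_alt:
  "set xs \<subseteq> {s, t} \<Longrightarrow> \<exists>k\<le>length xs. word xs = alt s t k \<or> word xs = alt t s k"
proof (induction xs)
  case (Cons r xs)
  then obtain k where k: "k \<le> length xs" "word xs = alt s t k \<or> word xs = alt t s k" by auto
  have *: "\<exists>j\<le>Suc k. \<sigma> r \<circ> alt s t k = alt s t j \<or> \<sigma> r \<circ> alt s t k = alt t s j"
    if r: "r = s \<or> r = t" for s t
  proof (cases k)
    case 0
    then show ?thesis using r by (intro exI[of _ "Suc 0"]) auto
  next
    case (Suc i)
    show ?thesis
    \<comment> \<open>Either \<open>r\<close> continues the alternation, or it equals the leftmost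
      letter and cancels it.\<close>
    proof (cases "r = (if even k then t else s)")
      case True
      then show ?thesis by (intro exI[of _ "Suc k"]) auto
    next
      case False
      then have "r = (if even i then t else s)" using r Suc by auto
      then have "\<sigma> r \<circ> alt s t k = alt s t i" using Suc by simp
      then show ?thesis using Suc by (intro exI[of _ i]) auto
    qed
  qed
  have "r = s \<or> r = t" using Cons.prems by auto
  then have "\<exists>j\<le>Suc k. \<sigma> r \<circ> word xs = alt s t j \<or> \<sigma> r \<circ> word xs = alt t s j"
    using k(2) *[of s t] *[of t s] by metis
  then obtain j where "j \<le> Suc k" "\<sigma> r \<circ> word xs = alt s t j \<or> \<sigma> r \<circ> word xs = alt t s j"
    by blast
  moreover from this(1) have "j \<le> length (r # xs)" using k(1) by simp
  ultimately show ?case unfolding word.simps(2) by blast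
qed auto

end

text \<open>Chebyshev polynomials of the second kind, shifted by one:
  \<open>cheb (cos \<theta>) k = sin (k \<theta>) / sin \<theta>\<close>.\<close>

fun cheb :: "real \<Rightarrow> nat \<Rightarrow> real" where
  "cheb c 0 = 0"
| "cheb c (Suc 0) = 1"
| "cheb c (Suc (Suc k)) = 2 * c * cheb c (Suc k) - cheb c k"

lemma cheb_one: "cheb 1 k = real k"
  by (induction "1::real" k rule: cheb.induct) auto

lemma cheb_cos: "cheb (cos \<theta>) k * sin \<theta> = sin (real k * \<theta>)"
proof (induction "cos \<theta>" k rule: cheb.induct)
  case (3 k)
  have "sin (real (Suc (Suc k)) * \<theta>) + sin (real k * \<theta>)
      = 2 * sin (real (Suc k) * \<theta>) * cos \<theta>"
    using sin_times_cos[of "real (Suc k) * \<theta>" \<theta>] by (simp add: algebra_simps)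
  then show ?case using 3 by (simp add: algebra_simps)
qed auto

context coxeter
begin

text \<open>Each further reflection replaces one of the two coefficients. The new one is
  \<open>2 * c * cheb c (Suc k) - cheb c k\<close> with \<open>c = - \<b> s t\<close>, which is the
  recursion of \<open>cheb\<close>.\<close>

lemma alt_simple_root:
  "alt s t k (\<alpha> s) = (\<lambda>x. cheb (- \<b> s t) (Suc k) * \<alpha> (if even k then s else t) x
                        + cheb (- \<b> s t) k * \<alpha> (if even k then t else s) x)"
proof (induction k)
  case (Suc k)
  let ?p = "if even k then s else t" and ?q = "if even k then t else s"
  let ?U = "cheb (- \<b> s t)"
  have lin: "\<sigma> ?q (\<lambda>x. ?U (Suc k) * \<alpha> ?p x + ?U k * \<alpha> ?q x)
     = (\<lambda>x. \<sigma> ?q (\<lambda>x. ?U (Suc k) * \<alpha> ?p x) x + ?U k * \<sigma> ?q (\<alpha> ?q) x)"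
    by (rule isom_lincomb[OF isom_simple_refl])
      (auto intro: finite_subset[of _ "{?p}"] simp: supp_def simple_root_def)
  have "\<sigma> ?q (\<lambda>x. ?U (Suc k) * \<alpha> ?p x) = (\<lambda>x. ?U (Suc k) * \<sigma> ?q (\<alpha> ?p) x)"
    by (rule isom_scale[OF isom_simple_refl]) simp
  moreover have "\<sigma> ?q (\<alpha> ?p) = (\<lambda>x. \<alpha> ?p x - 2 * \<b> s t * \<alpha> ?q x)"
    by (simp add: simple_refl_simple_root cox_b_sym[of t s])
  ultimately have "\<sigma> ?q (\<lambda>x. ?U (Suc k) * \<alpha> ?p x + ?U k * \<alpha> ?q x)
     = (\<lambda>x. ?U (Suc k) * (\<alpha> ?p x - 2 * \<b> s t * \<alpha> ?q x) - ?U k * \<alpha> ?q x)"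
    unfolding lin simple_refl_self by simp
  moreover have "alt s t (Suc k) (\<alpha> s) = \<sigma> ?q (\<lambda>x. ?U (Suc k) * \<alpha> ?p x + ?U k * \<alpha> ?q x)"
    by (simp add: Suc)
  ultimately show ?case by (auto simp: algebra_simps)
qed simp

section \<open>The braid relation and positivity in rank two\<close>

lemma refl_along_simple_root: "refl_along m (\<alpha> s) = \<sigma> s"
  by (simp add: simple_refl_def)

lemma isom_alt: "isom m (alt s t k)"
proof (induction k)
  case 0
  show "isom m (alt s t 0)" unfolding alt.simps(1) by (rule isom_id)
next
  case (Suc k)
  show "isom m (alt s t (Suc k))" unfolding alt.simps(2)
    by (rule isom_comp[OF isom_simple_refl Suc])
qed

text \<open>With \<open>\<theta> = pi / n\<close> the values are
  \<open>sin (k * \<theta>) / sin \<theta>\<close>: nonnegative up to \<open>k = n\<close>, zero at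
  \<open>n\<close>, and 1 at \<open>n - 1\<close> because
  \<open>sin (pi - \<theta>) = sin \<theta>\<close>.\<close>

lemma cheb_finite_bond:
  assumes "s \<noteq> t" "m s t = enat n"
  shows "n \<ge> 2" "k \<le> n \<Longrightarrow> cheb (- \<b> s t) k \<ge> 0"
    "cheb (- \<b> s t) n = 0" "cheb (- \<b> s t) (n - 1) = 1"
proof -
  have "m s t \<ge> 2" using assms(1) coxeter_matrix by (simp add: coxeter_matrix_def)
  then show n: "n \<ge> 2" using assms(2) by (simp add: numeral_eq_enat)
  define \<theta> where "\<theta> = pi / real n"
  have c: "- \<b> s t = cos \<theta>" by (simp add: cox_b_def assms(2) \<theta>_def)
  have n\<theta>: "real n * \<theta> = pi" using n by (simp add: \<theta>_def)
  have "0 < \<theta>" "\<theta> < pi" using n by (auto simp: \<theta>_def field_simps)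
  then have sin: "sin \<theta> > 0" by (rule sin_gt_zero)
  show "cheb (- \<b> s t) k \<ge> 0" if "k \<le> n"
  proof -
    have "real k * \<theta> \<le> real n * \<theta>" using that \<open>0 < \<theta>\<close> by (intro mult_right_mono) auto
    then have "sin (real k * \<theta>) \<ge> 0" using \<open>0 < \<theta>\<close> n\<theta> by (intro sin_ge_zero) auto
    then show ?thesis using cheb_cos[of \<theta> k] sin c by (metis not_le mult_neg_pos)
  qed
  show "cheb (- \<b> s t) n = 0" using cheb_cos[of \<theta> n] sin c n\<theta> by simp
  have "real (n - 1) * \<theta> = pi - \<theta>" using n n\<theta> by (simp add: of_nat_diff algebra_simps)
  then show "cheb (- \<b> s t) (n - 1) = 1" using cheb_cos[of \<theta> "n - 1"] sin c by simp
qed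

text \<open>The right-hand side is \<open>alt t s n\<close>, so this is the braid relation. At
  \<open>k = n - 1\<close> the coefficients are 0 and 1, hence \<open>alt s t (n - 1)\<close>
  carries \<open>\<alpha> s\<close> to a simple root and conjugates \<open>\<sigma> s\<close> to the
  simple reflection of that root.\<close>

lemma braid:
  assumes "s \<noteq> t" "m s t = enat n"
  shows "alt s t n = alt s t (n - 1) \<circ> \<sigma> s"
proof -
  note n = cheb_finite_bond[OF assms]
  let ?q = "if even (n - 1) then t else s"
  have "alt s t (n - 1) (\<alpha> s) = \<alpha> ?q"
    using n(1,3,4) alt_simple_root[of s t "n - 1"] by (simp del: alt.simps)
  then have "\<sigma> ?q \<circ> alt s t (n - 1) = alt s t (n - 1) \<circ> \<sigma> s"
    using refl_along_conj[OF isom_alt, of "\<alpha> s" s t "n - 1"]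
    by (simp add: refl_along_simple_root)
  moreover have "alt s t (Suc (n - 1)) = \<sigma> ?q \<circ> alt s t (n - 1)" by simp
  ultimately show ?thesis using n(1) by (simp del: alt.simps)
qed

text \<open>The length hypothesis makes \<open>w\<close> an alternating product with no final
  \<open>s\<close> and, for a finite bond \<open>n\<close>, with fewer than \<open>n\<close>
  letters. In this range the Chebyshev coefficients of \<open>w (\<alpha> s)\<close> are
  nonnegative.\<close>

lemma dihedral_positive:
  assumes "s \<noteq> t" and w: "w \<in> W {s, t}"
    and le: "len {s, t} w \<le> len {s, t} (w \<circ> \<sigma> s)"
  shows "\<exists>a\<ge>0. \<exists>b\<ge>0. w (\<alpha> s) = (\<lambda>x. a * \<alpha> s x + b * \<alpha> t x)"
proof -
  let ?l = "len {s, t}"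
  obtain k where k: "k \<le> ?l w" "w = alt s t k \<or> w = alt t s k"
    using reduced_word[OF w] word_alt by metis
  have alt_le: "?l (alt s t j) \<le> j" for j using alt_word[of s t j] len_word_le by metis
  \<comment> \<open>If the rightmost letter were \<open>s\<close>, composing with
    \<open>\<sigma> s\<close> would delete it and shorten \<open>w\<close>.\<close>
  have w_eq: "w = alt s t k"
  proof (cases k)
    case (Suc j)
    show ?thesis
    proof (rule ccontr)
      assume "w \<noteq> alt s t k"
      then have "w \<circ> \<sigma> s = alt s t j" using k(2) Suc alt_Suc_right[of t s j] by simp
      then show False using alt_le[of j] le k(1) Suc by simp
    qed
  qed (use k in simp)
  have "cheb (- \<b> s t) (Suc k) \<ge> 0 \<and> cheb (- \<b> s t) k \<ge> 0"
  proof (cases "m s t")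
    case (enat n)
    \<comment> \<open>Otherwise the braid relation rewrites the rightmost \<open>n\<close> letters
      so that they end in \<open>s\<close>, and \<open>w \<circ> \<sigma> s\<close> needs only
      \<open>k - 1\<close> letters.\<close>
    have "k < n"
    proof (rule ccontr)
      assume "\<not> k < n"
      then obtain ys where ys: "set ys \<subseteq> {s, t}" "length ys = k - n"
        "alt s t k = word ys \<circ> alt s t n" using alt_split[of n k s t] by auto
      obtain zs where zs: "set zs \<subseteq> {s, t}" "length zs = n - 1" "word zs = alt s t (n - 1)"
        using alt_word by metis
      have "w \<circ> \<sigma> s = word (ys @ zs)"
        using w_eq ys(3) zs(3) braid[OF assms(1) enat] by (simp add: word_append comp_assoc simple_refl_invol)
      then have "?l (w \<circ> \<sigma> s) \<le> length (ys @ zs)"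
        using len_word_le[of "ys @ zs" "{s, t}"] ys(1) zs(1) by simp
      also have "\<dots> < k" using ys(2) zs(2) \<open>\<not> k < n\<close> cheb_finite_bond(1)[OF assms(1) enat] by simp
      finally show False using le k(1) by simp
    qed
    then show ?thesis using cheb_finite_bond(2)[OF assms(1) enat] by simp
  next
    case infinity
    then have "- \<b> s t = 1" by (simp add: cox_b_def)
    then show ?thesis by (simp add: cheb_one del: cheb.simps)
  qed
  moreover have "w (\<alpha> s) = (if even k
      then (\<lambda>x. cheb (- \<b> s t) (Suc k) * \<alpha> s x + cheb (- \<b> s t) k * \<alpha> t x)
      else (\<lambda>x. cheb (- \<b> s t) k * \<alpha> s x + cheb (- \<b> s t) (Suc k) * \<alpha> t x))"
    using alt_simple_root[of s t k] w_eq by (simp add: add.commute)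
  ultimately show ?thesis by (cases "even k") auto
qed

text \<open>The argument of Humphreys, \<^emph>\<open>Reflection Groups and Coxeter Groups\<close>, Theorem 5.4, relative to \<open>J\<close>:
  split off from \<open>w\<close> a right factor \<open>u\<close> in the dihedral group of \<open>s\<close> and the last letter of \<open>w\<close>,
  with left factor as short as possible. Assuming \<open>\<le>\<close> instead of \<open><\<close> avoids parity of the length.\<close>

lemma positive_of_len_le:
  assumes "w \<in> W J" "s \<in> J" "len J w \<le> len J (w \<circ> \<sigma> s)"
  shows "w (\<alpha> s) x \<ge> 0"
  using assms
proof (induction "len J w" arbitrary: w s x rule: less_induct)
  case less
  obtain ws where ws: "set ws \<subseteq> J" "length ws = len J w" "word ws = w"
    using reduced_word[OF less.prems(1)] .
  show ?case
  proof (cases ws rule: rev_cases)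
    case Nil
    then show ?thesis using ws(3) by (simp add: simple_root_def)
  next
    case (snoc xs t)
    have xs: "set xs \<subseteq> J" "t \<in> J" using ws(1) snoc by auto
    have w: "w = word xs \<circ> \<sigma> t" using ws(3) snoc by (simp add: word_snoc)
    have len_xs: "len J (word xs) < len J w" using len_word_le[OF xs(1)] ws(2) snoc by simp
    have "s \<noteq> t" using less.prems(3) len_xs by (auto simp: w)
    let ?I = "{s, t}"
    have IJ: "?I \<subseteq> J" using less.prems(2) xs(2) by simp
    define P where "P n \<longleftrightarrow> (\<exists>v u. v \<in> W J \<and> u \<in> W ?I \<and> w = v \<circ> u
                        \<and> len J v + len ?I u \<le> len J w \<and> len J v = n)" for n
    \<comment> \<open>Splitting off just the last letter is one admissible factorization; it makes
      the minimal \<open>v\<close> shorter than \<open>w\<close>, as the induction hypothesis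
      requires.\<close>
    have "P (len J (word xs))" unfolding P_def
      using word_in_W[OF xs(1)] gen_by_incl[of "\<sigma> t" "\<sigma> ` ?I"] w len_xs len_simple_le[of t ?I]
      by (intro exI[of _ "word xs"] exI[of _ "\<sigma> t"]) auto
    then have P: "P (LEAST n. P n)" and Pmin: "(LEAST n. P n) \<le> len J (word xs)"
      by (rule LeastI) (rule Least_le, fact)
    then obtain v u where v: "v \<in> W J" and u: "u \<in> W ?I" and vu: "w = v \<circ> u"
      and sum: "len J v + len ?I u \<le> len J w" and vmin: "len J v = (LEAST n. P n)"
      unfolding P_def by blast
    have v_pos: "v (\<alpha> r) x \<ge> 0" if r: "r \<in> ?I" for r x
    proof -
      have \<sigma>r: "\<sigma> r \<in> W ?I" using r by (intro gen_by_incl) auto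
      have vr: "v \<circ> \<sigma> r \<in> W J" using v \<sigma>r gen_by_mono[of "\<sigma> ` ?I" "\<sigma> ` J"] IJ gen_by_comp by blast
      \<comment> \<open>If not, moving the letter \<open>r\<close> from \<open>v\<close> to
        \<open>u\<close> keeps the bound on the sum of lengths and shortens
        \<open>v\<close>.\<close>
      have "len J v \<le> len J (v \<circ> \<sigma> r)"
      proof (rule ccontr)
        assume less: "\<not> len J v \<le> len J (v \<circ> \<sigma> r)"
        have "len ?I (\<sigma> r \<circ> u) \<le> Suc (len ?I u)"
          using len_comp_le[OF subset_refl \<sigma>r u] len_simple_le[OF r] by simp
        then have "len J (v \<circ> \<sigma> r) + len ?I (\<sigma> r \<circ> u) \<le> len J w" using less sum by simp
        moreover have "w = (v \<circ> \<sigma> r) \<circ> (\<sigma> r \<circ> u)" by (simp add: vu comp_assoc)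
        ultimately have "P (len J (v \<circ> \<sigma> r))"
          unfolding P_def using vr gen_by_comp[OF \<sigma>r u] by blast
        then show False using less vmin Least_le[of P] by metis
      qed
      moreover have "len J v < len J w" using vmin Pmin len_xs by simp
      moreover have "r \<in> J" using r IJ by blast
      ultimately show ?thesis using less.hyps v by blast
    qed
    have "len ?I u \<le> len ?I (u \<circ> \<sigma> s)"
    proof (rule ccontr)
      assume "\<not> len ?I u \<le> len ?I (u \<circ> \<sigma> s)"
      moreover have "len J (w \<circ> \<sigma> s) \<le> len J v + len ?I (u \<circ> \<sigma> s)"
        unfolding vu comp_assoc
        by (rule len_comp_le[OF IJ v gen_by_comp[OF u gen_by_incl]]) auto
      ultimately show False using sum less.prems(3) by simp
    qed
    from dihedral_positive[OF \<open>s \<noteq> t\<close> u this] obtain a b where ab: "a \<ge> 0" "b \<ge> 0"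
      "u (\<alpha> s) = (\<lambda>x. a * \<alpha> s x + b * \<alpha> t x)" by blast
    have "w (\<alpha> s) = v (\<lambda>x. a * \<alpha> s x + b * \<alpha> t x)" using vu ab(3) by simp
    also have "\<dots> = (\<lambda>x. v (\<lambda>x. a * \<alpha> s x) x + b * v (\<alpha> t) x)"
      by (rule isom_lincomb[OF isom_W[OF v]])
        (auto intro: finite_subset[of _ "{s}"] simp: supp_def simple_root_def)
    also have "\<dots> = (\<lambda>x. a * v (\<alpha> s) x + b * v (\<alpha> t) x)"
      by (subst isom_scale[OF isom_W[OF v]]) simp_all
    finally show ?thesis using v_pos[of s x] v_pos[of t x] ab by simp
  qed
qed

section \<open>Roots\<close>

lemma cox_W_eq: "cox_W m = W UNIV"
  by (simp add: cox_W_def)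

lemma W_UNIV: "w \<in> W J \<Longrightarrow> w \<in> W UNIV"
  using gen_by_mono[of "\<sigma> ` J" "range \<sigma>"] by blast

lemma W_simple_refl: "s \<in> J \<Longrightarrow> \<sigma> s \<in> W J"
  by (rule gen_by_incl) simp

lemma isom_negate_root: "isom m w \<Longrightarrow> w (\<sigma> s (\<alpha> s)) = (\<lambda>x. - w (\<alpha> s) x)"
  using isom_scale[of m w "\<alpha> s" "-1"] by (simp add: simple_refl_self)

text \<open>Positivity applied to \<open>w \<circ> \<sigma> s\<close>, which sends
  \<open>\<alpha> s\<close> to the negative of \<open>w (\<alpha> s)\<close>.\<close>

lemma negative_of_len_le:
  assumes "w \<in> W J" "s \<in> J" "len J (w \<circ> \<sigma> s) \<le> len J w"
  shows "w (\<alpha> s) x \<le> 0"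
proof -
  have "w \<circ> \<sigma> s \<in> W J" using assms(1,2) by (intro gen_by_comp W_simple_refl)
  from positive_of_len_le[OF this assms(2), of x] assms(3)
  show ?thesis by (simp add: isom_negate_root[OF isom_W[OF assms(1)]])
qed

lemma roots_iff: "\<gamma> \<in> roots m \<longleftrightarrow> (\<exists>w\<in>W UNIV. \<exists>s. \<gamma> = w (\<alpha> s))"
  by (auto simp: roots_def cox_W_eq)

lemma W_root: "w \<in> W UNIV \<Longrightarrow> \<gamma> \<in> roots m \<Longrightarrow> w \<gamma> \<in> roots m"
  unfolding roots_iff by (metis comp_apply gen_by_comp)

lemma simple_root_in_roots: "\<alpha> s \<in> roots m"
  unfolding roots_iff using gen_by_id by (metis id_apply)

lemma root_finite_supp: "\<gamma> \<in> roots m \<Longrightarrow> finite (supp \<gamma>)"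
  by (auto simp: roots_iff intro: isom_finite[OF isom_W])

lemma root_norm: "\<gamma> \<in> roots m \<Longrightarrow> cox_B m \<gamma> \<gamma> = 1"
  by (auto simp: roots_iff isom_cox_B[OF isom_W] cox_B_simple_roots)

lemma root_nonzero: "\<gamma> \<in> roots m \<Longrightarrow> \<exists>x. \<gamma> x \<noteq> 0"
proof (rule ccontr)
  assume "\<gamma> \<in> roots m" "\<not> (\<exists>x. \<gamma> x \<noteq> 0)"
  then show False using root_norm[of \<gamma>] by (simp add: cox_B_def)
qed

text \<open>The lengths of \<open>w\<close> and \<open>w \<circ> \<sigma> s\<close> are comparable,
  so one of the two sign lemmas applies.\<close>

lemma root_sign:
  assumes "\<gamma> \<in> roots m"
  shows "(\<forall>x. \<gamma> x \<ge> 0) \<or> (\<forall>x. \<gamma> x \<le> 0)"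
proof -
  obtain w s where w: "w \<in> W UNIV" "\<gamma> = w (\<alpha> s)" using assms roots_iff by blast
  show ?thesis
    using positive_of_len_le[OF w(1) UNIV_I, of s] negative_of_len_le[OF w(1) UNIV_I, of s] w(2)
    by (meson le_cases)
qed

lemma root_uminus: "\<gamma> \<in> roots m \<Longrightarrow> (\<lambda>x. - \<gamma> x) \<in> roots m"
proof -
  assume "\<gamma> \<in> roots m"
  then obtain w s where w: "w \<in> W UNIV" "\<gamma> = w (\<alpha> s)" using roots_iff by blast
  have "(\<lambda>x. - \<gamma> x) = w (\<sigma> s (\<alpha> s))" using isom_negate_root[OF isom_W[OF w(1)]] w(2) by simp
  then show ?thesis by (simp add: W_root w(1) W_simple_refl simple_root_in_roots)
qed

lemma refl_along_uminus: "refl_along m (\<lambda>x. - \<gamma> x) = refl_along m \<gamma>"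
proof -
  have "supp (\<lambda>x. - \<gamma> x) = supp \<gamma>" by (simp add: supp_def)
  then show ?thesis by (simp add: refl_along_def cox_B_def sum_negf)
qed

section \<open>Positive roots under simple reflections\<close>

lemma pos_rootD: "\<gamma> \<in> pos_roots m \<Longrightarrow> \<gamma> \<in> roots m" "\<gamma> \<in> pos_roots m \<Longrightarrow> \<gamma> x \<ge> 0"
  by (auto simp: pos_roots_def)

lemma simple_root_pos: "\<alpha> s \<in> pos_roots m"
  using simple_root_in_roots[of s] unfolding pos_roots_def by (simp add: simple_root_def)

text \<open>Unit norm forces the only coordinate to be 1 or -1, and positivity leaves 1.\<close>

lemma pos_root_concentrated:
  assumes "\<gamma> \<in> pos_roots m" "\<And>x. x \<noteq> s \<Longrightarrow> \<gamma> x = 0"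
  shows "\<gamma> = \<alpha> s"
proof -
  have "supp \<gamma> \<subseteq> {s}" using assms(2) by (auto simp: supp_def)
  then have "cox_B m \<gamma> \<gamma> = \<gamma> s * \<gamma> s" by (simp add: cox_B_on[of "{s}" _ "{s}"])
  then have "\<gamma> s * \<gamma> s = 1" using root_norm pos_rootD(1)[OF assms(1)] by simp
  then have "\<gamma> s = 1" using pos_rootD(2)[OF assms(1), of s] by (auto simp: square_eq_1_iff)
  then show ?thesis using assms(2) by (auto simp: simple_root_def)
qed

text \<open>A positive root other than \<open>\<alpha> s\<close> has a positive coordinate away from
  \<open>s\<close>. The reflection \<open>\<sigma> s\<close> keeps it, and one positive coordinate
  decides the sign of a root.\<close>

lemma simple_refl_pos_root:
  assumes "\<gamma> \<in> pos_roots m" "\<gamma> \<noteq> \<alpha> s"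
  shows "\<sigma> s \<gamma> \<in> pos_roots m"
proof -
  obtain x where x: "x \<noteq> s" "\<gamma> x \<noteq> 0" using pos_root_concentrated assms by blast
  then have "\<gamma> x > 0" using pos_rootD(2)[OF assms(1), of x] by simp
  then have "\<sigma> s \<gamma> x > 0" using x by (simp add: simple_refl_other)
  moreover have "\<sigma> s \<gamma> \<in> roots m" using W_simple_refl[OF UNIV_I] pos_rootD(1)[OF assms(1)] by (rule W_root)
  ultimately show ?thesis using root_sign[of "\<sigma> s \<gamma>"]
    unfolding pos_roots_def by (auto simp: not_le[symmetric])
qed

text \<open>Away from \<open>s\<close> the left side vanishes, so every nonnegative summand does. An
  indexed family is used because the roots \<open>f i\<close> arise as images under group
  elements.\<close>

lemma simple_root_indecomposable:
  assumes "finite I" "\<And>i. i \<in> I \<Longrightarrow> f i \<in> pos_roots m" "\<And>i. i \<in> I \<Longrightarrow> c i > 0"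
    and eq: "\<And>x. \<alpha> s x = (\<Sum>i\<in>I. c i * f i x)" and "i \<in> I"
  shows "f i = \<alpha> s"
proof (rule pos_root_concentrated)
  fix x assume "x \<noteq> s"
  then have "(\<Sum>i\<in>I. c i * f i x) = 0" using eq[of x] by (simp add: simple_root_def)
  moreover have "c i * f i x \<ge> 0" if "i \<in> I" for i
    using assms(3)[OF that] pos_rootD(2)[OF assms(2)[OF that], of x] by simp
  ultimately have "c i * f i x = 0" using assms(1,5) by (simp add: sum_nonneg_eq_0_iff)
  then show "f i x = 0" using assms(3)[OF assms(5)] by simp
qed (use assms in auto)

section \<open>Canonical generators of a reflection subgroup\<close>

text \<open>The conjugate of \<open>G\<close> by \<open>s\<close> is written as a preimage; this is
  the same set since \<open>\<sigma> s\<close> is an involution.\<close>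

lemma roots_of_conj:
  assumes "\<gamma> \<in> roots m"
  shows "\<gamma> \<in> roots_of m {f. \<sigma> s \<circ> f \<circ> \<sigma> s \<in> G} \<longleftrightarrow> \<sigma> s \<gamma> \<in> roots_of m G"
proof -
  have inv: "inv (\<sigma> s) = \<sigma> s" by (rule inv_unique_comp) (rule simple_refl_invol)+
  have "\<sigma> s \<circ> refl_along m \<gamma> \<circ> \<sigma> s = refl_along m (\<sigma> s \<gamma>)"
    using refl_along_conj_inv[OF isom_simple_refl root_finite_supp[OF assms], of s] inv by simp
  then show ?thesis using assms W_root[OF W_simple_refl[of s UNIV]] by (simp add: roots_of_def)
qed

text \<open>As \<open>\<alpha> s\<close> is a root of neither group, \<open>\<sigma> s\<close>
  matches their positive roots. A forbidden decomposition of \<open>\<sigma> s \<delta>\<close>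
  would therefore be carried to one of \<open>\<delta>\<close>.\<close>

lemma simple_roots_of_conj:
  assumes s: "\<alpha> s \<notin> roots_of m G"
    and \<delta>: "\<delta> \<in> simple_roots_of m {f. \<sigma> s \<circ> f \<circ> \<sigma> s \<in> G}" (is "\<delta> \<in> simple_roots_of m ?G'")
  shows "\<sigma> s \<delta> \<in> simple_roots_of m G"
proof -
  have "\<sigma> s \<circ> \<sigma> s \<circ> \<sigma> s = \<sigma> s" by simp
  then have s': "\<alpha> s \<notin> roots_of m ?G'"
    using s by (simp add: roots_of_def refl_along_simple_root simple_root_in_roots)
  have \<delta>': "\<delta> \<in> roots_of m ?G'" "\<delta> \<in> pos_roots m" using \<delta> by (auto simp: simple_roots_of_def)
  have "\<sigma> s \<delta> \<in> roots_of m G" using \<delta>' by (simp add: roots_of_conj pos_rootD)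
  moreover have "\<sigma> s \<delta> \<in> pos_roots m" using \<delta>' s' by (metis simple_refl_pos_root)
  moreover have False
    if B: "finite B" "B \<subseteq> roots_of m G \<inter> pos_roots m" "\<not> B \<subseteq> {\<sigma> s \<delta>}" "\<forall>\<beta>\<in>B. c \<beta> > (0::real)"
      and eq: "\<forall>x. \<sigma> s \<delta> x = (\<Sum>\<beta>\<in>B. c \<beta> * \<beta> x)" for B c
  proof -
    let ?B = "\<sigma> s ` B"
    have "\<sigma> s \<beta> \<in> roots_of m ?G' \<inter> pos_roots m" if "\<beta> \<in> B" for \<beta>
    proof -
      have \<beta>: "\<beta> \<in> roots_of m G" "\<beta> \<in> pos_roots m" using that B(2) by auto
      then have "\<sigma> s \<beta> \<in> pos_roots m" using s by (metis simple_refl_pos_root)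
      with \<beta> show ?thesis by (simp add: roots_of_conj pos_rootD)
    qed
    then have "?B \<subseteq> roots_of m ?G' \<inter> pos_roots m" by blast
    moreover have "\<not> ?B \<subseteq> {\<delta>}"
    proof
      assume "?B \<subseteq> {\<delta>}"
      then have "\<sigma> s (\<sigma> s \<beta>) = \<sigma> s \<delta>" if "\<beta> \<in> B" for \<beta> using that by auto
      then show False using B(3) by auto
    qed
    moreover have "\<forall>\<beta>\<in>?B. c (\<sigma> s \<beta>) > 0" using B(4) by auto
    moreover have "\<delta> x = (\<Sum>\<beta>\<in>?B. c (\<sigma> s \<beta>) * \<beta> x)" for x
    proof -
      have "\<sigma> s \<delta> = (\<lambda>x. \<Sum>\<beta>\<in>B. c \<beta> * \<beta> x)" using eq by blast
      then have "\<sigma> s (\<sigma> s \<delta>) = \<sigma> s (\<lambda>x. \<Sum>\<beta>\<in>B. c \<beta> * \<beta> x)" by (rule arg_cong)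
      also have "\<dots> = (\<lambda>x. \<Sum>\<beta>\<in>B. c \<beta> * \<sigma> s \<beta> x)"
        using B(1,2) by (intro isom_sum[OF isom_simple_refl]) (auto intro: root_finite_supp pos_rootD)
      finally have "\<delta> x = (\<Sum>\<beta>\<in>B. c \<beta> * \<sigma> s \<beta> x)" by (simp add: fun_eq_iff)
      also have "\<dots> = (\<Sum>\<beta>\<in>?B. c (\<sigma> s \<beta>) * \<beta> x)"
        by (subst sum.reindex) (auto intro!: inj_on_inverseI[where g = "\<sigma> s"])
      finally show ?thesis .
    qed
    ultimately have "\<delta> \<notin> simple_roots_of m ?G'"
      using B(1) unfolding simple_roots_of_def
      by (auto intro!: exI[of _ ?B] exI[of _ "\<lambda>\<beta>. c (\<sigma> s \<beta>)"])
    then show False using \<delta> by simp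
  qed
  ultimately show ?thesis unfolding simple_roots_of_def by blast
qed

text \<open>Induction along a word that makes \<open>\<gamma>\<close> negative, conjugating \<open>G\<close> by the last letter \<open>s\<close>.
  If \<open>\<alpha>\<^sub>s\<close> is a root of \<open>G\<close> it is canonical and \<open>G\<close> does not change; otherwise \<open>s\<close> transports
  the canonical roots, because it permutes the positive roots other than \<open>\<alpha>\<^sub>s\<close>.\<close>

lemma refl_along_in_gen_by_canonical_gens_word:
  assumes "\<And>f g. f \<in> G \<Longrightarrow> g \<in> G \<Longrightarrow> f \<circ> g \<in> G"
    and "\<gamma> \<in> roots_of m G" "\<gamma> \<in> pos_roots m" "\<not> (\<forall>x. word xs \<gamma> x \<ge> 0)"
  shows "refl_along m \<gamma> \<in> gen_by (canonical_gens m G)"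
  using assms
proof (induction xs arbitrary: G \<gamma> rule: rev_induct)
  case Nil
  then show ?case by (simp add: pos_rootD)
next
  case (snoc s xs)
  have simple: "\<alpha> s \<in> simple_roots_of m G" if "\<alpha> s \<in> roots_of m G"
  proof -
    have "B \<subseteq> {\<alpha> s}"
      if "finite B" "B \<subseteq> roots_of m G \<inter> pos_roots m" "\<forall>\<beta>\<in>B. c \<beta> > 0"
        "\<forall>x. \<alpha> s x = (\<Sum>\<beta>\<in>B. c \<beta> * \<beta> x)" for B and c :: "('a \<Rightarrow> real) \<Rightarrow> real"
      using simple_root_indecomposable[of B "\<lambda>\<beta>. \<beta>" c s] that by blast
    then show ?thesis using that simple_root_pos unfolding simple_roots_of_def by blast
  qed
  show ?case
  proof (cases "\<gamma> = \<alpha> s")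
    case True
    then show ?thesis using simple snoc.prems(2) by (simp add: canonical_gens_def gen_by_incl)
  next
    case False
    let ?G' = "{f. \<sigma> s \<circ> f \<circ> \<sigma> s \<in> G}"
    have pos: "\<sigma> s \<gamma> \<in> pos_roots m" by (rule simple_refl_pos_root[OF snoc.prems(3) False])
    have neg: "\<not> (\<forall>x. word xs (\<sigma> s \<gamma>) x \<ge> 0)" using snoc.prems(4) by (simp add: word_snoc)
    have \<gamma>: "\<gamma> \<in> roots m" using snoc.prems(3) by (rule pos_rootD)
    have inv: "inv (\<sigma> s) = \<sigma> s" by (rule inv_unique_comp) (rule simple_refl_invol)+
    have conj: "\<sigma> s \<circ> refl_along m (\<sigma> s \<gamma>) \<circ> \<sigma> s = refl_along m \<gamma>"
      using refl_along_conj_inv[OF isom_simple_refl, of "\<sigma> s \<gamma>" s] root_finite_supp[OF pos_rootD(1)[OF pos]] inv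
      by simp
    show ?thesis
    proof (cases "\<alpha> s \<in> roots_of m G")
      case True
      have sG: "\<sigma> s \<in> G" using True by (simp add: roots_of_def refl_along_simple_root)
      have "refl_along m \<gamma> \<in> G" using snoc.prems(2) by (simp add: roots_of_def)
      then have "\<sigma> s \<circ> refl_along m \<gamma> \<circ> \<sigma> s \<in> G" using snoc.prems(1) sG by blast
      then have "\<gamma> \<in> roots_of m ?G'" using \<gamma> by (simp add: roots_of_def)
      then have "\<sigma> s \<gamma> \<in> roots_of m G" using roots_of_conj[OF \<gamma>] by simp
      then have "refl_along m (\<sigma> s \<gamma>) \<in> gen_by (canonical_gens m G)"
        using snoc.IH[OF snoc.prems(1) _ pos neg] by blast
      moreover have "\<sigma> s \<in> gen_by (canonical_gens m G)"
        using simple[OF True] by (intro gen_by_incl) (force simp: canonical_gens_def refl_along_simple_root)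
      ultimately have "\<sigma> s \<circ> refl_along m (\<sigma> s \<gamma>) \<circ> \<sigma> s \<in> gen_by (canonical_gens m G)"
        by (intro gen_by_comp)
      then show ?thesis using conj by simp
    next
      case False
      have closed: "f \<circ> g \<in> ?G'" if "f \<in> ?G'" "g \<in> ?G'" for f g
      proof -
        have "(\<sigma> s \<circ> f \<circ> \<sigma> s) \<circ> (\<sigma> s \<circ> g \<circ> \<sigma> s) = \<sigma> s \<circ> (f \<circ> g) \<circ> \<sigma> s"
          by (simp add: comp_def)
        moreover have "(\<sigma> s \<circ> f \<circ> \<sigma> s) \<circ> (\<sigma> s \<circ> g \<circ> \<sigma> s) \<in> G"
          using snoc.prems(1) that by blast
        ultimately show ?thesis by (metis mem_Collect_eq)
      qed
      have "\<sigma> s \<gamma> \<in> roots_of m ?G'"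
        using roots_of_conj[OF pos_rootD(1)[OF pos]] snoc.prems(2) by simp
      then have "refl_along m (\<sigma> s \<gamma>) \<in> gen_by (canonical_gens m ?G')"
        using snoc.IH[OF closed _ pos neg] by blast
      from gen_by_conj[OF isom_bij[OF isom_simple_refl] this, of s]
      have "refl_along m \<gamma> \<in> gen_by ((\<lambda>f. \<sigma> s \<circ> f \<circ> \<sigma> s) ` canonical_gens m ?G')"
        unfolding inv conj .
      moreover have "(\<lambda>f. \<sigma> s \<circ> f \<circ> \<sigma> s) ` canonical_gens m ?G' \<subseteq> canonical_gens m G"
      proof -
        have "\<sigma> s \<circ> refl_along m \<delta> \<circ> \<sigma> s \<in> canonical_gens m G"
          if \<delta>: "\<delta> \<in> simple_roots_of m ?G'" for \<delta>
        proof -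
          have "\<delta> \<in> roots m" using \<delta> by (auto simp: simple_roots_of_def roots_of_def)
          then have "\<sigma> s \<circ> refl_along m \<delta> \<circ> \<sigma> s = refl_along m (\<sigma> s \<delta>)"
            using refl_along_conj_inv[OF isom_simple_refl root_finite_supp, of \<delta> s] inv by simp
          then show ?thesis using simple_roots_of_conj[OF False \<delta>] by (simp add: canonical_gens_def)
        qed
        then show ?thesis by (auto simp: canonical_gens_def)
      qed
      ultimately show ?thesis using gen_by_mono by blast
    qed
  qed
qed

text \<open>A positive root \<open>w (\<alpha> s)\<close> is made negative by a word for
  \<open>\<sigma> s \<circ> inv w\<close>, which feeds the previous induction. A negative root is
  replaced by its opposite, which has the same reflection.\<close>

lemma refl_along_in_gen_by_canonical_gens:
  assumes "\<And>f g. f \<in> G \<Longrightarrow> g \<in> G \<Longrightarrow> f \<circ> g \<in> G" and "\<gamma> \<in> roots m" "refl_along m \<gamma> \<in> G"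
  shows "refl_along m \<gamma> \<in> gen_by (canonical_gens m G)"
proof -
  have *: "refl_along m \<beta> \<in> gen_by (canonical_gens m G)"
    if \<beta>: "\<beta> \<in> pos_roots m" "refl_along m \<beta> \<in> G" for \<beta>
  proof -
    obtain w s where w: "w \<in> W UNIV" "\<beta> = w (\<alpha> s)"
      using pos_rootD(1)[OF \<beta>(1)] roots_iff by blast
    obtain xs where xs: "word xs = \<sigma> s \<circ> inv w"
      using W_word gen_by_comp[OF W_simple_refl W_inv[OF w(1)]] by (metis UNIV_I)
    have "word xs \<beta> = (\<lambda>x. - \<alpha> s x)"
      using w isom_inv_cancel(2)[OF isom_W[OF w(1)]] by (simp add: xs simple_refl_self)
    then have "word xs \<beta> s < 0" by (simp add: simple_root_def)
    then have "\<not> (\<forall>x. word xs \<beta> x \<ge> 0)" by (meson not_le)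
    moreover have "\<beta> \<in> roots_of m G" using \<beta> by (simp add: roots_of_def pos_rootD)
    ultimately show ?thesis
      using refl_along_in_gen_by_canonical_gens_word[OF assms(1) _ \<beta>(1)] by blast
  qed
  show ?thesis
    using root_sign[OF assms(2)]
  proof
    assume "\<forall>x. \<gamma> x \<ge> 0"
    then show ?thesis using * assms(2,3) by (simp add: pos_roots_def)
  next
    assume "\<forall>x. \<gamma> x \<le> 0"
    then have "(\<lambda>x. - \<gamma> x) \<in> pos_roots m" using root_uminus[OF assms(2)] by (simp add: pos_roots_def)
    from *[OF this] show ?thesis using assms(3) by (simp add: refl_along_uminus)
  qed
qed

lemma reflection_subgroup_eq_gen_by_canonical_gens:
  assumes "reflection_subgroup m G"
  shows "G = gen_by (canonical_gens m G)"
proof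
  obtain R where R: "R \<subseteq> reflections m" "G = gen_by R"
    using assms by (auto simp: reflection_subgroup_def)
  have closed: "f \<circ> g \<in> G" if "f \<in> G" "g \<in> G" for f g using that R(2) gen_by_comp by blast
  have "R \<subseteq> gen_by (canonical_gens m G)"
  proof
    fix r assume r: "r \<in> R"
    then obtain \<gamma> where \<gamma>: "\<gamma> \<in> roots m" "r = refl_along m \<gamma>" using R(1) by (auto simp: reflections_def)
    then show "r \<in> gen_by (canonical_gens m G)"
      using refl_along_in_gen_by_canonical_gens[OF closed \<gamma>(1)] gen_by_incl[OF r] R(2) by blast
  qed
  then show "G \<subseteq> gen_by (canonical_gens m G)"
    unfolding R(2) by (intro gen_by_least gen_by_id gen_by_comp)
  show "gen_by (canonical_gens m G) \<subseteq> G"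
  proof (rule gen_by_least)
    show "canonical_gens m G \<subseteq> G"
      by (auto simp: canonical_gens_def simple_roots_of_def roots_of_def)
    show "id \<in> G" unfolding R(2) by (rule gen_by_id)
  qed (rule closed)
qed

section \<open>Parabolic subgroups\<close>

text \<open>The parabolic subgroup \<open>w W\<^sub>I w\<^sup>-\<^sup>1\<close>, written as a
  preimage so that membership is a statement about \<open>W I\<close>.\<close>

definition par :: "(('a \<Rightarrow> real) \<Rightarrow> ('a \<Rightarrow> real)) \<Rightarrow> 'a set \<Rightarrow> (('a \<Rightarrow> real) \<Rightarrow> ('a \<Rightarrow> real)) set" where
  "par w I = {f. inv w \<circ> f \<circ> w \<in> W I}"

lemma simple_refl_conj_in_par:
  assumes "w \<in> W UNIV" "i \<in> I"
  shows "w \<circ> \<sigma> i \<circ> inv w \<in> par w I"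
proof -
  have "inv w \<circ> (w \<circ> \<sigma> i \<circ> inv w) \<circ> w = \<sigma> i"
    by (simp add: comp_def isom_inv_cancel[OF isom_W[OF assms(1)]])
  then show ?thesis using W_simple_refl[OF assms(2)] by (simp add: par_def)
qed

lemma refl_along_in_par:
  assumes "w \<in> W UNIV" "i \<in> I"
  shows "refl_along m (w (\<alpha> i)) \<in> par w I"
  using simple_refl_conj_in_par[OF assms] refl_along_conj_inv[OF isom_W[OF assms(1)], of "\<alpha> i"]
  by (simp add: refl_along_simple_root)

lemma conj_inv_conj:
  assumes "isom m w"
  shows "w \<circ> (inv w \<circ> f \<circ> w) \<circ> inv w = f" "inv w \<circ> (w \<circ> f \<circ> inv w) \<circ> w = f"
  using assms by (simp_all add: comp_def)

lemma par_least:
  assumes w: "w \<in> W UNIV" and "id \<in> G" "\<And>f g. f \<in> G \<Longrightarrow> g \<in> G \<Longrightarrow> f \<circ> g \<in> G"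
    and gen: "\<And>i. i \<in> I \<Longrightarrow> w \<circ> \<sigma> i \<circ> inv w \<in> G"
  shows "par w I \<subseteq> G"
proof
  fix f assume "f \<in> par w I"
  then have "inv w \<circ> f \<circ> w \<in> W I" by (simp add: par_def)
  from gen_by_conj[OF isom_bij[OF isom_W[OF w]] this]
  have "f \<in> gen_by ((\<lambda>f. w \<circ> f \<circ> inv w) ` \<sigma> ` I)"
    unfolding conj_inv_conj(1)[OF isom_W[OF w]] .
  moreover have "gen_by ((\<lambda>f. w \<circ> f \<circ> inv w) ` \<sigma> ` I) \<subseteq> G"
    using assms(2,3) gen by (intro gen_by_least) auto
  ultimately show "f \<in> G" by blast
qed

text \<open>Conjugation by \<open>u\<close> preserves \<open>W I\<close>, so the representative may
  vary within the coset of \<open>w\<close>.\<close>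

lemma par_comp:
  assumes w: "w \<in> W UNIV" and u: "u \<in> W I"
  shows "par (w \<circ> u) I = par w I"
proof -
  note iw = isom_W[OF w] and iu = isom_W[OF u]
  have inv: "inv (w \<circ> u) = inv u \<circ> inv w"
    using o_inv_distrib isom_bij[OF iw] isom_bij[OF iu] by blast
  have "inv (w \<circ> u) \<circ> f \<circ> (w \<circ> u) \<in> W I \<longleftrightarrow> inv w \<circ> f \<circ> w \<in> W I" for f
  proof
    assume "inv (w \<circ> u) \<circ> f \<circ> (w \<circ> u) \<in> W I"
    then have "u \<circ> (inv (w \<circ> u) \<circ> f \<circ> (w \<circ> u)) \<circ> inv u \<in> W I"
      by (rule gen_by_comp[OF gen_by_comp[OF u] W_inv[OF u]])
    moreover have "u \<circ> (inv (w \<circ> u) \<circ> f \<circ> (w \<circ> u)) \<circ> inv u = inv w \<circ> f \<circ> w"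
      unfolding inv by (simp add: comp_def isom_inv_cancel[OF iu])
    ultimately show "inv w \<circ> f \<circ> w \<in> W I" by metis
  next
    assume "inv w \<circ> f \<circ> w \<in> W I"
    then have "inv u \<circ> (inv w \<circ> f \<circ> w) \<circ> u \<in> W I"
      by (rule gen_by_comp[OF gen_by_comp[OF W_inv[OF u]] u])
    then show "inv (w \<circ> u) \<circ> f \<circ> (w \<circ> u) \<in> W I" unfolding inv by (simp add: comp_assoc)
  qed
  then show ?thesis by (simp add: par_def)
qed

text \<open>Take a shortest element of the coset \<open>w W\<^sub>I\<close>: no
  \<open>\<sigma> i\<close> with \<open>i\<close> in \<open>I\<close> shortens it from the right, so
  positivity applies.\<close>

lemma par_positive_rep:
  assumes "w \<in> W UNIV"
  obtains v where "v \<in> W UNIV" "par v I = par w I" "\<And>i x. i \<in> I \<Longrightarrow> v (\<alpha> i) x \<ge> 0"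
proof -
  obtain u where u: "u \<in> W I" and min: "\<And>u'. u' \<in> W I \<Longrightarrow> len UNIV (w \<circ> u) \<le> len UNIV (w \<circ> u')"
    using ex_has_least_nat[of "\<lambda>u. u \<in> W I" id "\<lambda>u. len UNIV (w \<circ> u)"] gen_by_id by metis
  have wu: "w \<circ> u \<in> W UNIV" using assms W_UNIV[OF u] gen_by_comp by blast
  show ?thesis
  proof
    show "w \<circ> u \<in> W UNIV" by fact
    show "par (w \<circ> u) I = par w I" by (rule par_comp[OF assms u])
    fix i x assume "i \<in> I"
    then have "u \<circ> \<sigma> i \<in> W I" using u W_simple_refl gen_by_comp by blast
    from min[OF this] show "(w \<circ> u) (\<alpha> i) x \<ge> 0"
      by (intro positive_of_len_le[OF wu]) (simp_all add: comp_assoc)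
  qed
qed

section \<open>Intersections of parabolic subgroups\<close>

lemma W_fixes_outside: "w \<in> W I \<Longrightarrow> x \<notin> I \<Longrightarrow> w v x = v x"
proof (induction rule: gen_by_induct)
  case (step r w)
  then obtain s where "r = \<sigma> s" "x \<noteq> s" by blast
  then show ?case using step simple_refl_other[of x s "w v"] by simp
qed simp

text \<open>The reflection sends \<open>\<gamma>\<close> to its negative and so changes every
  coordinate in \<open>supp \<gamma>\<close>, whereas elements of \<open>W I\<close> change only
  those in \<open>I\<close>.\<close>

lemma root_supp_of_refl_in_W:
  assumes "\<gamma> \<in> roots m" "refl_along m \<gamma> \<in> W I"
  shows "supp \<gamma> \<subseteq> I"
proof
  fix x assume "x \<in> supp \<gamma>"
  then have "refl_along m \<gamma> \<gamma> x \<noteq> \<gamma> x"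
    using root_norm[OF assms(1)] by (simp add: refl_along_def supp_def)
  then show "x \<in> I" using W_fixes_outside[OF assms(2)] by blast
qed

text \<open>If the last letter of a reduced word of \<open>u\<close> is \<open>j\<close>, then \<open>w (d \<alpha>\<^sub>j)\<close> is negative while
  \<open>d \<alpha>\<^sub>j\<close> is positive; as \<open>w\<close> only changes coordinates in \<open>I\<close>, this puts \<open>d \<alpha>\<^sub>j\<close> in the span
  of the \<open>\<alpha>\<^sub>i\<close>, \<open>i \<in> I\<close>, and applying \<open>d\<^sup>-\<^sup>1\<close> shows that \<open>d \<alpha>\<^sub>j\<close> is one of them.\<close>

lemma double_coset_intersection:
  assumes d: "d \<in> W UNIV" and dJ: "\<And>j x. j \<in> J \<Longrightarrow> d (\<alpha> j) x \<ge> 0"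
    and dI: "\<And>i x. i \<in> I \<Longrightarrow> inv d (\<alpha> i) x \<ge> 0"
    and "w \<in> W I" "u \<in> W J" "w \<circ> d = d \<circ> u"
  shows "w \<in> W {i \<in> I. \<exists>j\<in>J. d (\<alpha> j) = \<alpha> i}" (is "w \<in> W ?K")
  using assms(4-6)
proof (induction "len J u" arbitrary: u w rule: less_induct)
  case less
  note idd = isom_W[OF d]
  obtain us where us: "set us \<subseteq> J" "length us = len J u" "word us = u"
    using reduced_word[OF less.prems(2)] .
  show ?case
  proof (cases us rule: rev_cases)
    case Nil
    then have "w \<circ> d = d" using us(3) less.prems(3) by simp
    then have "w \<circ> d \<circ> inv d = d \<circ> inv d" by simp
    then have "w = id" using isom_inv_cancel(3)[OF idd] by (simp add: comp_assoc)
    then show ?thesis by (simp only: gen_by_id)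
  next
    case (snoc xs j)
    let ?u = "word xs"
    have j: "j \<in> J" and xs: "set xs \<subseteq> J" using us(1) snoc by auto
    have u: "u = ?u \<circ> \<sigma> j" using us(3) snoc by (simp add: word_snoc)
    have len: "len J ?u < len J u" using len_word_le[OF xs] us(2) snoc by simp
    have neg: "u (\<alpha> j) x \<le> 0" for x
      by (rule negative_of_len_le[OF less.prems(2) j]) (use len in \<open>simp add: u\<close>)
    have suppJ: "supp (u (\<alpha> j)) \<subseteq> J"
    proof
      fix x assume "x \<in> supp (u (\<alpha> j))"
      then have "u (\<alpha> j) x \<noteq> 0" by (simp add: supp_def)
      moreover have "\<alpha> j x = 0" if "x \<notin> J" using that j by (auto simp: simple_root_def)
      ultimately show "x \<in> J" using W_fixes_outside[OF less.prems(2), of x "\<alpha> j"] by auto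
    qed
    have fin: "finite (supp (u (\<alpha> j)))"
      using isom_finite[OF isom_W[OF less.prems(2)]] by simp
    have "d (u (\<alpha> j)) = d (\<lambda>x. \<Sum>i\<in>supp (u (\<alpha> j)). u (\<alpha> j) i * \<alpha> i x)"
      by (rule arg_cong[OF simple_root_expansion[OF fin subset_refl]])
    also have "\<dots> = (\<lambda>x. \<Sum>i\<in>supp (u (\<alpha> j)). u (\<alpha> j) i * d (\<alpha> i) x)"
      by (rule isom_sum[OF idd fin]) simp
    finally have expJ: "d (u (\<alpha> j)) x = (\<Sum>i\<in>supp (u (\<alpha> j)). u (\<alpha> j) i * d (\<alpha> i) x)" for x
      by (rule fun_cong)
    have "d (u (\<alpha> j)) x \<le> 0" for x
      unfolding expJ using suppJ dJ by (intro sum_nonpos mult_nonpos_nonneg neg) blast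
    moreover have "w (d (\<alpha> j)) = d (u (\<alpha> j))" using fun_cong[OF less.prems(3), of "\<alpha> j"] by simp
    ultimately have wneg: "w (d (\<alpha> j)) x \<le> 0" for x by simp
    let ?\<beta> = "d (\<alpha> j)"
    have \<beta>: "?\<beta> \<in> roots m" using d simple_root_in_roots by (rule W_root)
    have supp\<beta>: "supp ?\<beta> \<subseteq> I"
    proof
      fix x assume "x \<in> supp ?\<beta>"
      then have "?\<beta> x > 0" using dJ[OF j, of x] by (simp add: supp_def)
      \<comment> \<open>Outside \<open>I\<close> the coordinate would survive under
        \<open>w\<close>, hence be both positive and nonpositive.\<close>
      then show "x \<in> I" using W_fixes_outside[OF less.prems(1), of x ?\<beta>] wneg[of x]
        by (cases "x \<in> I") auto
    qed
    have fin\<beta>: "finite (supp ?\<beta>)" using \<beta> by (rule root_finite_supp)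
    have "inv d ?\<beta> = inv d (\<lambda>x. \<Sum>i\<in>supp ?\<beta>. ?\<beta> i * \<alpha> i x)"
      by (rule arg_cong[OF simple_root_expansion[OF fin\<beta> subset_refl]])
    also have "\<dots> = (\<lambda>x. \<Sum>i\<in>supp ?\<beta>. ?\<beta> i * inv d (\<alpha> i) x)"
      by (rule isom_sum[OF isom_W[OF W_inv[OF d]] fin\<beta>]) simp
    finally have exp: "\<alpha> j x = (\<Sum>i\<in>supp ?\<beta>. ?\<beta> i * inv d (\<alpha> i) x)" for x
      unfolding isom_inv_cancel(2)[OF idd] by (rule fun_cong)
    obtain i where i: "i \<in> supp ?\<beta>" using root_nonzero[OF \<beta>] by (auto simp: supp_def)
    have "inv d (\<alpha> i) = \<alpha> j"
    proof (rule simple_root_indecomposable[where f = "\<lambda>i. inv d (\<alpha> i)", OF fin\<beta> _ _ exp i])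
      fix k assume k: "k \<in> supp ?\<beta>"
      show "inv d (\<alpha> k) \<in> pos_roots m"
        using k supp\<beta> dI W_root[OF W_inv[OF d] simple_root_in_roots] by (auto simp: pos_roots_def)
      show "?\<beta> k > 0" using k dJ[OF j, of k] by (simp add: supp_def)
    qed
    then have di: "d (\<alpha> j) = \<alpha> i" using isom_inv_cancel(1)[OF idd, of "\<alpha> i"] by simp
    have iK: "i \<in> ?K" using i supp\<beta> j di by blast
    have ds: "\<sigma> i \<circ> d = d \<circ> \<sigma> j"
      using refl_along_conj[OF idd, of "\<alpha> j"] di by (simp add: refl_along_simple_root)
    \<comment> \<open>Because \<open>d\<close> carries \<open>\<alpha> j\<close> to
      \<open>\<alpha> i\<close>, removing \<open>j\<close> from the right of \<open>u\<close>
      corresponds to removing \<open>i\<close> from the right of \<open>w\<close>.\<close>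
    have "w \<circ> \<sigma> i \<in> W ?K"
    proof (rule less.hyps[OF len])
      show "w \<circ> \<sigma> i \<in> W I" using iK less.prems(1) by (intro gen_by_comp W_simple_refl) auto
      show "?u \<in> W J" by (rule word_in_W[OF xs])
      have "w \<circ> \<sigma> i \<circ> d = w \<circ> d \<circ> \<sigma> j" by (simp add: comp_assoc ds)
      also have "\<dots> = d \<circ> ?u \<circ> \<sigma> j \<circ> \<sigma> j" unfolding less.prems(3) by (simp add: u comp_assoc)
      finally show "w \<circ> \<sigma> i \<circ> d = d \<circ> ?u" by simp
    qed
    then have "w \<circ> \<sigma> i \<circ> \<sigma> i \<in> W ?K" by (rule gen_by_comp[OF _ W_simple_refl[OF iK]])
    then show ?thesis by simp
  qed
qed

text \<open>Let \<open>d\<close> be shortest in the double coset of \<open>inv x \<circ> y\<close>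
  modulo \<open>W I\<close> and \<open>W J\<close>. With \<open>z = x \<circ> a\<close> the two
  groups become \<open>par z I\<close> and \<open>par (z \<circ> d) J\<close>, and minimality of
  \<open>d\<close> gives the sign conditions of \<open>double_coset_intersection\<close>.\<close>

lemma par_Int:
  assumes x: "x \<in> W UNIV" and y: "y \<in> W UNIV"
  obtains a K where "a \<in> W I" "K \<subseteq> I" "par x I \<inter> par y J = par (x \<circ> a) K"
proof -
  define g where "g = inv x \<circ> y"
  have g: "g \<in> W UNIV" unfolding g_def using W_inv[OF x] y by (rule gen_by_comp)
  obtain a b where ab: "a \<in> W I" "b \<in> W J"
    and min: "\<And>a' b'. a' \<in> W I \<Longrightarrow> b' \<in> W J \<Longrightarrow>
        len UNIV (inv a \<circ> g \<circ> b) \<le> len UNIV (inv a' \<circ> g \<circ> b')"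
    using ex_has_least_nat[of "\<lambda>(a, b). a \<in> W I \<and> b \<in> W J" "(id, id)"
        "\<lambda>(a, b). len UNIV (inv a \<circ> g \<circ> b)"] gen_by_id by fastforce
  define d where "d = inv a \<circ> g \<circ> b"
  define z where "z = x \<circ> a"
  have d: "d \<in> W UNIV" unfolding d_def
    using W_UNIV[OF W_inv[OF ab(1)]] g W_UNIV[OF ab(2)] by (intro gen_by_comp)
  have z: "z \<in> W UNIV" unfolding z_def using x W_UNIV[OF ab(1)] by (rule gen_by_comp)
  note iz = isom_W[OF z] and idd = isom_W[OF d]
  have dJ: "d (\<alpha> j) t \<ge> 0" if j: "j \<in> J" for j t
  proof (rule positive_of_len_le[OF d UNIV_I])
    have "b \<circ> \<sigma> j \<in> W J" using ab(2) W_simple_refl[OF j] by (rule gen_by_comp)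
    from min[OF ab(1) this] show "len UNIV d \<le> len UNIV (d \<circ> \<sigma> j)"
      by (simp add: d_def comp_assoc)
  qed
  have dI: "inv d (\<alpha> i) t \<ge> 0" if i: "i \<in> I" for i t
  proof (rule positive_of_len_le[OF W_inv[OF d] UNIV_I])
    have \<sigma>d: "\<sigma> i \<circ> d \<in> W UNIV" using W_simple_refl d by (intro gen_by_comp) auto
    have "inv (a \<circ> \<sigma> i) = \<sigma> i \<circ> inv a" and inv\<sigma>d: "inv (\<sigma> i \<circ> d) = inv d \<circ> \<sigma> i"
      by (rule inv_unique_comp;
          simp add: comp_def isom_inv_cancel[OF idd] isom_inv_cancel[OF isom_W[OF ab(1)]] id_def)+
    moreover have "a \<circ> \<sigma> i \<in> W I" using ab(1) W_simple_refl[OF i] by (rule gen_by_comp)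
    \<comment> \<open>Minimality is tested with \<open>a \<circ> \<sigma> i\<close> in place of
      \<open>a\<close>; invariance of length under inversion then turns left multiplication of
      \<open>d\<close> into right multiplication of \<open>inv d\<close>.\<close>
    ultimately have "len UNIV d \<le> len UNIV (\<sigma> i \<circ> d)"
      using min[OF _ ab(2), of "a \<circ> \<sigma> i"] by (simp add: d_def comp_assoc)
    then show "len UNIV (inv d) \<le> len UNIV (inv d \<circ> \<sigma> i)"
      using len_inv[OF d] len_inv[OF \<sigma>d] inv\<sigma>d by simp
  qed
  let ?K = "{i \<in> I. \<exists>j\<in>J. d (\<alpha> j) = \<alpha> i}"
  have yb: "y \<circ> b = z \<circ> d"
    by (simp add: z_def d_def g_def comp_def isom_inv_cancel[OF isom_W[OF ab(1)]]
        isom_inv_cancel[OF isom_W[OF x]])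
  have pz: "par x I = par z I" unfolding z_def using par_comp[OF x ab(1)] by simp
  have pzd: "par y J = par (z \<circ> d) J" using par_comp[OF y ab(2)] yb by simp
  have invzd: "inv (z \<circ> d) = inv d \<circ> inv z"
    using o_inv_distrib isom_bij[OF iz] isom_bij[OF idd] by blast
  have "par z I \<inter> par (z \<circ> d) J = par z ?K"
  proof
    show "par z I \<inter> par (z \<circ> d) J \<subseteq> par z ?K"
    proof
      fix f assume "f \<in> par z I \<inter> par (z \<circ> d) J"
      then have wI: "inv z \<circ> f \<circ> z \<in> W I" and uJ: "inv d \<circ> inv z \<circ> f \<circ> (z \<circ> d) \<in> W J"
        by (auto simp: par_def invzd)
      have "inv z \<circ> f \<circ> z \<circ> d = d \<circ> (inv d \<circ> inv z \<circ> f \<circ> (z \<circ> d))"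
        by (simp add: comp_def isom_inv_cancel[OF idd])
      from double_coset_intersection[OF d dJ dI wI uJ this] show "f \<in> par z ?K"
        by (simp add: par_def)
    qed
    show "par z ?K \<subseteq> par z I \<inter> par (z \<circ> d) J"
    proof
      fix f assume "f \<in> par z ?K"
      then have w: "inv z \<circ> f \<circ> z \<in> W ?K" by (simp add: par_def)
      then have "f \<in> par z I" using gen_by_mono[of "\<sigma> ` ?K" "\<sigma> ` I"] by (auto simp: par_def)
      moreover have "f \<in> par (z \<circ> d) J"
      proof -
        have "inv (inv d) = d" by (rule inv_inv_W[OF d])
        then have "inv d \<circ> (inv z \<circ> f \<circ> z) \<circ> d \<in> gen_by ((\<lambda>f. inv d \<circ> f \<circ> d) ` \<sigma> ` ?K)"
          using gen_by_conj[OF isom_bij[OF isom_W[OF W_inv[OF d]]] w] by simp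
        moreover have "(\<lambda>f. inv d \<circ> f \<circ> d) ` \<sigma> ` ?K \<subseteq> \<sigma> ` J"
        proof -
          have "inv d \<circ> \<sigma> i \<circ> d = \<sigma> j" if "d (\<alpha> j) = \<alpha> i" for i j
          proof -
            have "\<sigma> i \<circ> d = d \<circ> \<sigma> j"
              using refl_along_conj[OF idd, of "\<alpha> j"] that by (simp add: refl_along_simple_root)
            then have "inv d \<circ> \<sigma> i \<circ> d = inv d \<circ> d \<circ> \<sigma> j" by (simp add: comp_assoc)
            then show ?thesis using isom_inv_cancel(4)[OF idd] by simp
          qed
          then show ?thesis by blast
        qed
        ultimately have "inv d \<circ> (inv z \<circ> f \<circ> z) \<circ> d \<in> W J" using gen_by_mono by blast
        then show ?thesis by (simp add: par_def invzd comp_assoc)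
      qed
      ultimately show "f \<in> par z I \<inter> par (z \<circ> d) J" by blast
    qed
  qed
  then show ?thesis using that[OF ab(1), of ?K] pz pzd by (auto simp: z_def)
qed

text \<open>Choose \<open>par x I\<close> around \<open>X\<close> with \<open>card I\<close>
  minimal. Intersecting with \<open>par y J\<close> gives \<open>par (x \<circ> a) K\<close> with
  \<open>K \<subseteq> I\<close>, still containing \<open>X\<close>, so \<open>K = I\<close> and the
  intersection is all of \<open>par x I\<close>. The competing \<open>J\<close> may be
  infinite.\<close>

lemma parabolic_closure:
  assumes "x\<^sub>0 \<in> W UNIV" "finite I\<^sub>0" "X \<subseteq> par x\<^sub>0 I\<^sub>0"
  obtains x I where "x \<in> W UNIV" "finite I" "X \<subseteq> par x I"
    "\<And>y J. y \<in> W UNIV \<Longrightarrow> X \<subseteq> par y J \<Longrightarrow> par x I \<subseteq> par y J"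
proof -
  let ?P = "\<lambda>(x, I). x \<in> W UNIV \<and> finite I \<and> X \<subseteq> par x I"
  have "?P (x\<^sub>0, I\<^sub>0)" using assms by simp
  from ex_has_least_nat[of ?P, OF this, of "\<lambda>(x, I). card I"] obtain x I
    where x: "x \<in> W UNIV" and I: "finite I" "X \<subseteq> par x I"
    and min: "\<And>y J. y \<in> W UNIV \<Longrightarrow> finite J \<Longrightarrow> X \<subseteq> par y J \<Longrightarrow> card I \<le> card J"
    by (auto simp: split_paired_all)
  have "par x I \<subseteq> par y J" if y: "y \<in> W UNIV" "X \<subseteq> par y J" for y J
  proof -
    obtain a K where a: "a \<in> W I" and K: "K \<subseteq> I" and eq: "par x I \<inter> par y J = par (x \<circ> a) K"
      using par_Int[OF x y(1)] .
    have "card I \<le> card K"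
    proof (rule min)
      show "x \<circ> a \<in> W UNIV" using x W_UNIV[OF a] by (rule gen_by_comp)
      show "finite K" using K I(1) by (rule finite_subset)
      show "X \<subseteq> par (x \<circ> a) K" using I(2) y(2) eq by blast
    qed
    then have "K = I" using K I(1) by (meson card_seteq)
    then show ?thesis using eq par_comp[OF x a] by auto
  qed
  then show ?thesis using that x I by blast
qed

section \<open>Locally parabolic subgroups\<close>

lemma locally_parabolic_contains_par:
  assumes G: "locally_parabolic m G" and "finite X" "X \<subseteq> G"
  obtains v I where "v \<in> W UNIV" "finite I" "X \<subseteq> par v I" "par v I \<subseteq> G"
proof -
  have Geq: "G = gen_by (canonical_gens m G)"
    using G by (intro reflection_subgroup_eq_gen_by_canonical_gens) (simp add: locally_parabolic_def)
  then have "X \<subseteq> gen_by (canonical_gens m G)" using assms(3) by simp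
  from gen_by_finite_set[OF assms(2) this] obtain F
    where F: "finite F" "F \<subseteq> canonical_gens m G" "X \<subseteq> gen_by F" by blast
  from G F(1,2) obtain w where w: "w \<in> W UNIV" "(\<lambda>f. w \<circ> f \<circ> inv w) ` F \<subseteq> range \<sigma>"
    unfolding locally_parabolic_def cox_W_eq by blast
  from finite_subset_image[OF finite_imageI[OF F(1)] w(2)] obtain I
    where I: "finite I" "(\<lambda>f. w \<circ> f \<circ> inv w) ` F = \<sigma> ` I" by blast
  note iw = isom_W[OF w(1)] and inv_w = inv_inv_W[OF w(1)]
  have id_G: "id \<in> G" by (subst Geq) (rule gen_by_id)
  have comp_G: "f \<circ> g \<in> G" if "f \<in> G" "g \<in> G" for f g
    using that Geq gen_by_comp by blast
  have "X \<subseteq> par (inv w) I"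
  proof
    fix f assume "f \<in> X"
    then have "f \<in> gen_by F" using F(3) by blast
    from gen_by_conj[OF isom_bij[OF iw] this] show "f \<in> par (inv w) I"
      by (simp add: par_def I(2) inv_w)
  qed
  moreover have "par (inv w) I \<subseteq> G"
  proof (rule par_least[OF W_inv[OF w(1)] id_G comp_G])
    fix i assume "i \<in> I"
    then have "\<sigma> i \<in> (\<lambda>f. w \<circ> f \<circ> inv w) ` F" unfolding I(2) by (rule imageI)
    then obtain f where f: "f \<in> F" "\<sigma> i = w \<circ> f \<circ> inv w" by blast
    have "inv w \<circ> \<sigma> i \<circ> inv (inv w) = f"
      unfolding f(2) inv_w by (rule conj_inv_conj(2)[OF iw])
    moreover have "f \<in> G" using f(1) F(2) gen_by_incl[of f "canonical_gens m G"] Geq by blast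
    ultimately show "inv w \<circ> \<sigma> i \<circ> inv (inv w) \<in> G" by simp
  qed
  ultimately show ?thesis using that W_inv[OF w(1)] I(1) by blast
qed

section \<open>From parabolic subgroups around finite sets to local parabolicity\<close>

lemma simple_roots_ofD:
  assumes "\<gamma> \<in> simple_roots_of m G" "finite B" "B \<subseteq> roots_of m G \<inter> pos_roots m"
    and "\<forall>\<beta>\<in>B. c \<beta> > (0::real)" "\<forall>x. \<gamma> x = (\<Sum>\<beta>\<in>B. c \<beta> * \<beta> x)"
  shows "B \<subseteq> {\<gamma>}"
proof (rule ccontr)
  assume "\<not> B \<subseteq> {\<gamma>}"
  with assms(2-5) have "\<exists>B c. finite B \<and> B \<subseteq> roots_of m G \<inter> pos_roots m \<and> \<not> B \<subseteq> {\<gamma>}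
      \<and> (\<forall>\<beta>\<in>B. c \<beta> > (0::real)) \<and> (\<forall>x. \<gamma> x = (\<Sum>\<beta>\<in>B. c \<beta> * \<beta> x))"
    by (intro exI[of _ B] exI[of _ c] conjI)
  then show False using assms(1) unfolding simple_roots_of_def mem_Collect_eq by (elim conjE notE)
qed

text \<open>The root \<open>inv v \<gamma>\<close> is supported in \<open>I\<close>, so
  \<open>\<gamma>\<close> is a combination of the roots \<open>v (\<alpha> i)\<close>. Its
  coefficients are nonnegative, as otherwise \<open>\<gamma>\<close> would be negative too. These
  roots are positive roots of \<open>G\<close>, and a canonical root has only the trivial
  decomposition.\<close>

lemma simple_root_of_in_par:
  assumes v: "v \<in> W UNIV" and pos: "\<And>i x. i \<in> I \<Longrightarrow> v (\<alpha> i) x \<ge> 0"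
    and sub: "par v I \<subseteq> G"
    and \<gamma>: "\<gamma> \<in> simple_roots_of m G" and in_par: "refl_along m \<gamma> \<in> par v I"
  shows "\<exists>i\<in>I. \<gamma> = v (\<alpha> i)"
proof -
  note iv = isom_W[OF v]
  have \<gamma>_pos: "\<gamma> \<in> pos_roots m" and \<gamma>_root: "\<gamma> \<in> roots m"
    using \<gamma> by (auto simp: simple_roots_of_def pos_rootD)
  define \<beta> where "\<beta> = inv v \<gamma>"
  have v\<beta>: "v \<beta> = \<gamma>" unfolding \<beta>_def using iv by simp
  have \<beta>: "\<beta> \<in> roots m" unfolding \<beta>_def using W_inv[OF v] \<gamma>_root by (rule W_root)
  have "inv v \<circ> refl_along m \<gamma> \<circ> v = refl_along m \<beta>"
    using refl_along_conj_inv[OF isom_W[OF W_inv[OF v]] root_finite_supp[OF \<gamma>_root]] inv_inv_W[OF v]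
    by (simp add: \<beta>_def)
  then have "refl_along m \<beta> \<in> W I" using in_par by (simp add: par_def)
  then have suppI: "supp \<beta> \<subseteq> I" by (rule root_supp_of_refl_in_W[OF \<beta>])
  have fin: "finite (supp \<beta>)" using \<beta> by (rule root_finite_supp)
  have "v \<beta> = v (\<lambda>x. \<Sum>i\<in>supp \<beta>. \<beta> i * \<alpha> i x)"
    by (rule arg_cong[OF simple_root_expansion[OF fin subset_refl]])
  also have "\<dots> = (\<lambda>x. \<Sum>i\<in>supp \<beta>. \<beta> i * v (\<alpha> i) x)" by (rule isom_sum[OF iv fin]) simp
  finally have \<gamma>_sum: "\<gamma> x = (\<Sum>i\<in>supp \<beta>. \<beta> i * v (\<alpha> i) x)" for x using v\<beta> by simp
  have "\<forall>i. \<beta> i \<ge> 0"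
  proof (rule ccontr)
    assume "\<not> (\<forall>i. \<beta> i \<ge> 0)"
    then have "\<forall>i. \<beta> i \<le> 0" using root_sign[OF \<beta>] by blast
    then have "\<gamma> x \<le> 0" for x
      unfolding \<gamma>_sum using pos suppI by (intro sum_nonpos mult_nonpos_nonneg) auto
    then have "\<gamma> x = 0" for x using pos_rootD(2)[OF \<gamma>_pos, of x] by (simp add: order_antisym)
    then show False using root_nonzero[OF \<gamma>_root] by blast
  qed
  then have \<beta>_pos: "\<beta> i > 0" if "i \<in> supp \<beta>" for i
    using that by (simp add: supp_def order_less_le)
  let ?f = "\<lambda>i. v (\<alpha> i)"
  \<comment> \<open>Decompositions are sums over sets of roots; injectivity moves the coefficients
    from indices \<open>i\<close> to roots \<open>v (\<alpha> i)\<close>.\<close>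
  have inj: "inj ?f"
  proof (rule injI)
    fix i j assume "v (\<alpha> i) = v (\<alpha> j)"
    then have "\<alpha> i = \<alpha> j" using isom_inv_cancel(2)[OF iv] by metis
    then have "\<alpha> i i = \<alpha> j i" by simp
    then show "i = j" by (simp add: simple_root_def split: if_splits)
  qed
  have inv_f: "inv ?f (v (\<alpha> i)) = i" for i using inv_f_f[OF inj] .
  let ?c = "\<lambda>\<delta>. \<beta> (inv ?f \<delta>)"
  have sub_pos: "?f ` supp \<beta> \<subseteq> roots_of m G \<inter> pos_roots m"
  proof -
    have "?f i \<in> roots_of m G \<inter> pos_roots m" if "i \<in> I" for i
      using that pos sub refl_along_in_par[OF v that] W_root[OF v simple_root_in_roots]
      by (auto simp: roots_of_def pos_roots_def)
    then show ?thesis using suppI by blast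
  qed
  have c_pos: "\<forall>\<delta>\<in>?f ` supp \<beta>. ?c \<delta> > 0" using \<beta>_pos by (auto simp: inv_f)
  have "\<forall>x. \<gamma> x = (\<Sum>\<delta>\<in>?f ` supp \<beta>. ?c \<delta> * \<delta> x)"
    by (simp add: \<gamma>_sum sum.reindex inj_on_subset[OF inj] inv_f)
  then have "?f ` supp \<beta> \<subseteq> {\<gamma>}"
    by (rule simple_roots_ofD[OF \<gamma> finite_imageI[OF fin] sub_pos c_pos])
  moreover obtain i where "i \<in> supp \<beta>" using root_nonzero[OF \<beta>] by (auto simp: supp_def)
  ultimately show ?thesis using suppI by blast
qed

lemma locally_parabolicI:
  assumes id_G: "id \<in> G" and comp_G: "\<And>f g. f \<in> G \<Longrightarrow> g \<in> G \<Longrightarrow> f \<circ> g \<in> G"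
    and par: "\<And>X. finite X \<Longrightarrow> X \<subseteq> G \<Longrightarrow> \<exists>v\<in>W UNIV. \<exists>I. X \<subseteq> par v I \<and> par v I \<subseteq> G"
  shows "locally_parabolic m G"
  unfolding locally_parabolic_def
proof (intro conjI allI impI)
  let ?R = "G \<inter> reflections m"
  \<comment> \<open>Every element of \<open>G\<close> lies in some \<open>par v I\<close> inside
    \<open>G\<close>, and the latter is generated by reflections.\<close>
  have "G = gen_by ?R"
  proof
    show "gen_by ?R \<subseteq> G" using id_G comp_G by (intro gen_by_least) auto
    show "G \<subseteq> gen_by ?R"
    proof
      fix f assume "f \<in> G"
      then obtain v I where v: "v \<in> W UNIV" "f \<in> par v I" "par v I \<subseteq> G" using par[of "{f}"] by auto
      have "par v I \<subseteq> gen_by ?R"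
      proof (rule par_least[OF v(1) gen_by_id gen_by_comp])
        fix i assume i: "i \<in> I"
        have "v \<circ> \<sigma> i \<circ> inv v = refl_along m (v (\<alpha> i))"
          using refl_along_conj_inv[OF isom_W[OF v(1)], of "\<alpha> i"] by (simp add: refl_along_simple_root)
        moreover have "refl_along m (v (\<alpha> i)) \<in> ?R"
          using refl_along_in_par[OF v(1) i] v(3) W_root[OF v(1) simple_root_in_roots]
          by (auto simp: reflections_def)
        ultimately show "v \<circ> \<sigma> i \<circ> inv v \<in> gen_by ?R" using gen_by_incl by metis
      qed
      then show "f \<in> gen_by ?R" using v(2) by blast
    qed
  qed
  then show "reflection_subgroup m G" unfolding reflection_subgroup_def by blast
next
  fix F assume "finite F \<and> F \<subseteq> canonical_gens m G"
  then have F: "finite F" "F \<subseteq> canonical_gens m G" by auto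
  moreover have "canonical_gens m G \<subseteq> G"
    by (auto simp: canonical_gens_def simple_roots_of_def roots_of_def)
  ultimately obtain v\<^sub>0 I where v0: "v\<^sub>0 \<in> W UNIV" "F \<subseteq> par v\<^sub>0 I" "par v\<^sub>0 I \<subseteq> G" using par[of F] by blast
  \<comment> \<open>A positive representative makes the canonical roots behind \<open>F\<close>
    images of simple roots under one \<open>v\<close>, so \<open>inv v\<close> conjugates all of
    \<open>F\<close> at once.\<close>
  obtain v where v: "v \<in> W UNIV" "par v I = par v\<^sub>0 I" "\<And>i x. i \<in> I \<Longrightarrow> v (\<alpha> i) x \<ge> 0"
    using par_positive_rep[OF v0(1), of I] by blast
  have "inv v \<circ> f \<circ> inv (inv v) \<in> range \<sigma>" if f: "f \<in> F" for f
  proof -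
    obtain \<gamma> where \<gamma>: "\<gamma> \<in> simple_roots_of m G" "f = refl_along m \<gamma>"
      using f F(2) by (auto simp: canonical_gens_def)
    obtain i where i: "\<gamma> = v (\<alpha> i)"
      using simple_root_of_in_par[OF v(1,3) _ \<gamma>(1), of I] f \<gamma>(2) v(2) v0(2,3) by blast
    have "f = v \<circ> \<sigma> i \<circ> inv v"
      using refl_along_conj_inv[OF isom_W[OF v(1)], of "\<alpha> i"] \<gamma>(2) i
      by (simp add: refl_along_simple_root)
    then have "inv v \<circ> f \<circ> inv (inv v) = \<sigma> i"
      using conj_inv_conj(2)[OF isom_W[OF v(1)]] inv_inv_W[OF v(1)] by simp
    then show ?thesis by simp
  qed
  then show "\<exists>w\<in>cox_W m. (\<lambda>f. w \<circ> f \<circ> inv w) ` F \<subseteq> range \<sigma>"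
    using W_inv[OF v(1)] unfolding cox_W_eq by blast
qed

lemma locally_parabolic_Inter:
  assumes "\<G> \<noteq> {}" "\<And>G. G \<in> \<G> \<Longrightarrow> locally_parabolic m G"
  shows "locally_parabolic m (\<Inter>\<G>)"
proof (rule locally_parabolicI)
  have G_gen: "G = gen_by (canonical_gens m G)" if "G \<in> \<G>" for G
    using assms(2)[OF that]
    by (intro reflection_subgroup_eq_gen_by_canonical_gens) (simp add: locally_parabolic_def)
  show "id \<in> \<Inter>\<G>"
  proof
    fix G assume "G \<in> \<G>"
    then show "id \<in> G" by (subst G_gen) (auto intro: gen_by_id simp del: id_apply)
  qed
  show "f \<circ> g \<in> \<Inter>\<G>" if "f \<in> \<Inter>\<G>" "g \<in> \<Inter>\<G>" for f g
  proof
    fix G assume G: "G \<in> \<G>"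
    then have "f \<in> G" "g \<in> G" using that by auto
    then show "f \<circ> g \<in> G" using G_gen[OF G] gen_by_comp by blast
  qed
  fix X :: "(('a \<Rightarrow> real) \<Rightarrow> 'a \<Rightarrow> real) set"
  assume X: "finite X" "X \<subseteq> \<Inter>\<G>"
  have in_G: "\<exists>v\<in>W UNIV. \<exists>I. finite I \<and> X \<subseteq> par v I \<and> par v I \<subseteq> G" if G: "G \<in> \<G>" for G
  proof -
    have "X \<subseteq> G" using X(2) G by blast
    then show ?thesis using locally_parabolic_contains_par[OF assms(2)[OF G] X(1)] by metis
  qed
  \<comment> \<open>Any one member supplies the parabolic subgroup of finite rank from which the
    closure is built.\<close>
  obtain G where "G \<in> \<G>" using assms(1) by blast
  with in_G obtain x\<^sub>0 I\<^sub>0 where "x\<^sub>0 \<in> W UNIV" "finite I\<^sub>0" "X \<subseteq> par x\<^sub>0 I\<^sub>0" by blast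
  then obtain x I where x: "x \<in> W UNIV" "X \<subseteq> par x I"
    and least: "\<And>y J. y \<in> W UNIV \<Longrightarrow> X \<subseteq> par y J \<Longrightarrow> par x I \<subseteq> par y J"
    using parabolic_closure by metis
  \<comment> \<open>The closure depends only on \<open>X\<close>, so the same \<open>par x I\<close>
    lies in every member.\<close>
  have "par x I \<subseteq> G" if "G \<in> \<G>" for G
    using in_G[OF that] least by blast
  then show "\<exists>v\<in>W UNIV. \<exists>I. X \<subseteq> par v I \<and> par v I \<subseteq> \<Inter>\<G>" using x by blast
qed

end

theorem theorem4p2:
  fixes m :: "'a \<Rightarrow> 'a \<Rightarrow> enat"
    and \<G> :: "(('a \<Rightarrow> real) \<Rightarrow> ('a \<Rightarrow> real)) set set"
  assumes "coxeter_matrix m"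
    and "\<G> \<noteq> {}"
    and "\<forall>G\<in>\<G>. locally_parabolic m G"
  shows "locally_parabolic m (\<Inter>\<G>)"
proof -
  interpret coxeter m by unfold_locales (fact assms(1))
  show ?thesis using assms(2,3) by (intro locally_parabolic_Inter) auto
qed

end
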